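(* Let $P$ be a finite poset. Then the order congruence lattice $\mathcal{O}(P)$ is comodernistic, and hence has a $CL$-labeling (is $CL$-shellable).
   Context: A map $\varphi:P\to Q$ of posets is order-preserving if $x\le y$ implies $\varphi(x)\le\varphi(y)$. The level set partition of $\varphi$ is the partition of $P$ into the nonempty sets $\varphi^{-1}(q)$. The order congruence lattice $\mathcal{O}(P)$ is the subposet of the lattice $\Pi_P$ of all set partitions of $P$ (ordered by refinement, finer below) consisting of level set partitions of order-preserving maps from $P$ to posets (equivalently, to $\mathbb{Z}$). An element $m$ of a lattice $L$ is left-modular if $(x\vee m)\wedge y=x\vee(m\wedge y)$ for all $x<y$ in $L$; a lattice is comodernistic if every interval $[u,v]$ has a coatom that is left-modular in $[u,v]$. A $CL$-labeling is a labeling of rooted cover relations (a cover $x\lessdot y$ together with a maximal chain from $\hat0$ to $x$) by integers such that in every rooted interval (an interval $[x,y]$ with a fixed maximal chain from $\hat 0$ to $x$) there is a unique maximal chain whose label word is strictly increasing, and this chain is lexicographically strictly first among the maximal chains of that rooted interval. *)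

theory Defs
  imports "HOL-Algebra.Lattice" "HOL-Library.Disjoint_Sets"
begin

section \<open>The order congruence lattice\<close>

definition order_preserving_map ::
  "('a, 'c) gorder_scheme \<Rightarrow> ('b, 'd) gorder_scheme \<Rightarrow> ('a \<Rightarrow> 'b) \<Rightarrow> bool" where
  "order_preserving_map P Q \<phi> \<longleftrightarrow>
     partial_order P \<and> partial_order Q \<and> \<phi> \<in> carrier P \<rightarrow> carrier Q \<and> isotone P Q \<phi>"

definition level_set_partition ::
  "('a, 'c) gorder_scheme \<Rightarrow> ('b, 'd) gorder_scheme \<Rightarrow> ('a \<Rightarrow> 'b) \<Rightarrow> 'a set set" where
  "level_set_partition P Q \<phi> = (\<lambda>q. {p \<in> carrier P. \<phi> p = q}) ` carrier Q - {{}}"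

text \<open>
  HOL cannot quantify over target posets \<open>Q\<close> of every type inside a definition. The targets below
  have their elements in the type \<^typ>\<open>'a set\<close>; lemma \<open>level_set_partition_in_order_congruences\<close>
  shows that targets of any other type yield no further partitions, and lemma
  \<open>order_congruences_eq_int\<close> that for finite \<open>P\<close> the integers suffice.
\<close>

definition order_congruences :: "('a, 'c) gorder_scheme \<Rightarrow> 'a set set set" where
  "order_congruences P =
     {level_set_partition P Q \<phi> | (Q :: 'a set gorder) \<phi>. order_preserving_map P Q \<phi>}"

definition order_congruence_lattice :: "('a, 'c) gorder_scheme \<Rightarrow> 'a set set gorder" where
  "order_congruence_lattice P =
     \<lparr>carrier = order_congruences P, eq = (=), le = refines (carrier P)\<rparr>"


section \<open>Comodernistic lattices\<close>

definition interval :: "('a, 'c) gorder_scheme \<Rightarrow> 'a \<Rightarrow> 'a \<Rightarrow> ('a, 'c) gorder_scheme" where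
  "interval L u v = L\<lparr>carrier := \<lbrace>u..v\<rbrace>\<^bsub>L\<^esub>\<rparr>"

definition covers :: "('a, 'c) gorder_scheme \<Rightarrow> 'a \<Rightarrow> 'a \<Rightarrow> bool" where
  "covers L x y \<longleftrightarrow> x \<in> carrier L \<and> y \<in> carrier L \<and> x \<sqsubset>\<^bsub>L\<^esub> y \<and>
     \<not> (\<exists>z\<in>carrier L. x \<sqsubset>\<^bsub>L\<^esub> z \<and> z \<sqsubset>\<^bsub>L\<^esub> y)"

definition coatom :: "('a, 'c) gorder_scheme \<Rightarrow> 'a \<Rightarrow> bool" where
  "coatom L m \<longleftrightarrow> covers L m \<top>\<^bsub>L\<^esub>"

definition left_modular :: "('a, 'c) gorder_scheme \<Rightarrow> 'a \<Rightarrow> bool" where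
  "left_modular L m \<longleftrightarrow> m \<in> carrier L \<and>
     (\<forall>x\<in>carrier L. \<forall>y\<in>carrier L. x \<sqsubset>\<^bsub>L\<^esub> y \<longrightarrow>
        (x \<squnion>\<^bsub>L\<^esub> m) \<sqinter>\<^bsub>L\<^esub> y = x \<squnion>\<^bsub>L\<^esub> (m \<sqinter>\<^bsub>L\<^esub> y))"

text \<open>One-element intervals are excluded, as they have no coatoms at all.\<close>

definition comodernistic :: "('a, 'c) gorder_scheme \<Rightarrow> bool" where
  "comodernistic L \<longleftrightarrow> lattice L \<and>
     (\<forall>u\<in>carrier L. \<forall>v\<in>carrier L. u \<sqsubset>\<^bsub>L\<^esub> v \<longrightarrow>
        (\<exists>m. coatom (interval L u v) m \<and> left_modular (interval L u v) m))"


section \<open>CL-labelings\<close>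

text \<open>
  A maximal chain of the interval from \<open>x\<close> to \<open>y\<close> is the list of its elements in increasing order;
  see lemma \<open>maximal_chain_iff\<close> for the description as inclusion-maximal chain.
\<close>

definition maximal_chain :: "('a, 'c) gorder_scheme \<Rightarrow> 'a \<Rightarrow> 'a \<Rightarrow> 'a list \<Rightarrow> bool" where
  "maximal_chain L x y c \<longleftrightarrow> c \<noteq> [] \<and> set c \<subseteq> carrier L \<and> hd c = x \<and> last c = y \<and>
     successively (covers L) c"

text \<open>
  A rooted cover relation is a maximal chain \<open>r\<close> from the bottom to some \<open>x\<close> together with a cover
  \<open>y\<close> of \<open>x\<close>. As \<open>x\<close> is the last element of \<open>r\<close>, a labeling is a function of \<open>r\<close> and \<open>y\<close>.
  The list \<open>ys\<close> in \<open>label_word lab r ys\<close> continues \<open>r\<close>, so the word of a maximal chain \<open>c\<close> of an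
  interval rooted at \<open>r\<close> is \<open>label_word lab r (tl c)\<close>.
\<close>

type_synonym 'a rooted_labeling = "'a list \<Rightarrow> 'a \<Rightarrow> int"

fun label_word :: "'a rooted_labeling \<Rightarrow> 'a list \<Rightarrow> 'a list \<Rightarrow> int list" where
  "label_word lab r [] = []"
| "label_word lab r (y # ys) = lab r y # label_word lab (r @ [y]) ys"

definition increasing_chain ::
  "('a, 'c) gorder_scheme \<Rightarrow> 'a rooted_labeling \<Rightarrow> 'a list \<Rightarrow> 'a \<Rightarrow> 'a \<Rightarrow> 'a list \<Rightarrow> bool" where
  "increasing_chain L lab r x y c \<longleftrightarrow>
     maximal_chain L x y c \<and> sorted_wrt (<) (label_word lab r (tl c))"

definition CL_labeling :: "('a, 'c) gorder_scheme \<Rightarrow> 'a rooted_labeling \<Rightarrow> bool" where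
  "CL_labeling L lab \<longleftrightarrow>
     (\<forall>x\<in>carrier L. \<forall>y\<in>carrier L. \<forall>r. x \<sqsubseteq>\<^bsub>L\<^esub> y \<and> maximal_chain L \<bottom>\<^bsub>L\<^esub> x r \<longrightarrow>
        (\<exists>c. increasing_chain L lab r x y c \<and>
             (\<forall>d. increasing_chain L lab r x y d \<longrightarrow> d = c) \<and>
             (\<forall>d. maximal_chain L x y d \<and> d \<noteq> c \<longrightarrow>
                (label_word lab r (tl c), label_word lab r (tl d)) \<in> lexord {(a, b). a < b})))"

definition CL_shellable :: "('a, 'c) gorder_scheme \<Rightarrow> bool" where
  "CL_shellable L \<longleftrightarrow> (\<exists>lab. CL_labeling L lab)"


section \<open>Consistency of the definitions\<close>

lemma partial_orderI:
  assumes "eq Q = (=)"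
    and "\<And>x. x \<in> carrier Q \<Longrightarrow> le Q x x"
    and "\<And>x y. \<lbrakk>le Q x y; le Q y x; x \<in> carrier Q; y \<in> carrier Q\<rbrakk> \<Longrightarrow> x = y"
    and "\<And>x y z. \<lbrakk>le Q x y; le Q y z; x \<in> carrier Q; y \<in> carrier Q; z \<in> carrier Q\<rbrakk> \<Longrightarrow> le Q x z"
  shows "partial_order Q"
  by unfold_locales (use assms in \<open>auto\<close>)

lemma order_preserving_mapD:
  assumes "order_preserving_map P Q \<phi>" "x \<in> carrier P"
  shows "\<phi> x \<in> carrier Q" "y \<in> carrier P \<Longrightarrow> le P x y \<Longrightarrow> le Q (\<phi> x) (\<phi> y)"
  using assms by (auto simp: order_preserving_map_def isotone_def)

lemma order_preserving_mapI:
  assumes "partial_order P" "partial_order Q"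
    and "\<And>x. x \<in> carrier P \<Longrightarrow> \<phi> x \<in> carrier Q"
    and "\<And>x y. \<lbrakk>x \<in> carrier P; y \<in> carrier P; le P x y\<rbrakk> \<Longrightarrow> le Q (\<phi> x) (\<phi> y)"
  shows "order_preserving_map P Q \<phi>"
  using assms by (auto simp: order_preserving_map_def isotone_def partial_order_def)

lemma level_set_partition_eq:
  assumes "\<phi> \<in> carrier P \<rightarrow> carrier Q"
  shows "level_set_partition P Q \<phi> = (\<lambda>p. {p' \<in> carrier P. \<phi> p' = \<phi> p}) ` carrier P"
  using assms by (force simp: level_set_partition_def)

lemma partition_on_level_set_partition:
  assumes "\<phi> \<in> carrier P \<rightarrow> carrier Q"
  shows "partition_on (carrier P) (level_set_partition P Q \<phi>)"
  unfolding level_set_partition_eq[OF assms] by (force simp: partition_on_def disjoint_def)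

lemma level_set_partition_cong:
  assumes "\<phi> \<in> carrier P \<rightarrow> carrier Q" "\<psi> \<in> carrier P \<rightarrow> carrier R"
    and "\<And>p p'. \<lbrakk>p \<in> carrier P; p' \<in> carrier P\<rbrakk> \<Longrightarrow> \<phi> p = \<phi> p' \<longleftrightarrow> \<psi> p = \<psi> p'"
  shows "level_set_partition P Q \<phi> = level_set_partition P R \<psi>"
  unfolding level_set_partition_eq[OF assms(1)] level_set_partition_eq[OF assms(2)]
  by (rule image_cong) (use assms(3) in auto)

lemma level_set_partition_in_order_congruences:
  assumes "order_preserving_map P Q \<phi>"
  shows "level_set_partition P Q \<phi> \<in> order_congruences P"
proof -
  interpret Q: partial_order Q
    using assms by (simp add: order_preserving_map_def)
  define b where "b q = {p \<in> carrier P. \<phi> p = q}" for q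
  have inj: "inj_on b (\<phi> ` carrier P)"
    by (auto simp: inj_on_def b_def)
  define g where "g = inv_into (\<phi> ` carrier P) b"
  have g: "g (b (\<phi> p)) = \<phi> p" if "p \<in> carrier P" for p
    unfolding g_def using inj that by (intro inv_into_f_f) auto
  have P: "\<phi> p \<in> carrier Q" if "p \<in> carrier P" for p
    using order_preserving_mapD[OF assms that] by simp
  define R :: "'a set gorder" where
    "R = \<lparr>carrier = b ` \<phi> ` carrier P, eq = (=), le = (\<lambda>B C. le Q (g B) (g C))\<rparr>"
  have "partial_order R"
  proof (rule partial_orderI)
    fix x y assume "le R x y" "le R y x" "x \<in> carrier R" "y \<in> carrier R"
    then show "x = y"
      using P by (auto simp: R_def g dest: Q.le_antisym)
  next
    fix x y z
    assume "le R x y" "le R y z" "x \<in> carrier R" "y \<in> carrier R" "z \<in> carrier R"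
    then show "le R x z"
      using P by (auto simp: R_def g intro: Q.le_trans)
  qed (use P in \<open>auto simp: R_def g\<close>)
  then have R: "order_preserving_map P R (\<lambda>p. b (\<phi> p))"
    using assms order_preserving_mapD[OF assms]
    by (intro order_preserving_mapI) (auto simp: R_def g order_preserving_map_def)
  have "level_set_partition P Q \<phi> = level_set_partition P R (\<lambda>p. b (\<phi> p))"
    using assms R inj
    by (intro level_set_partition_cong) (auto simp: order_preserving_map_def inj_on_def)
  with R show ?thesis
    unfolding order_congruences_def by blast
qed

abbreviation int_order :: "int gorder" where
  "int_order \<equiv> \<lparr>carrier = UNIV, eq = (=), le = (\<le>)\<rparr>"

lemma linear_extension:
  assumes "partial_order Q" "finite X" "X \<subseteq> carrier Q"
  shows "\<exists>f :: 'q \<Rightarrow> int. inj_on f X \<and> (\<forall>x\<in>X. \<forall>y\<in>X. le Q x y \<longrightarrow> f x \<le> f y)"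
  using assms(2,3)
proof (induction "card X" arbitrary: X)
  case 0
  then show ?case by auto
next
  case (Suc n)
  interpret Q: partial_order Q by fact
  let ?lt = "\<lambda>x y. le Q x y \<and> x \<noteq> y"
  have "X \<noteq> {}"
    using Suc by auto
  have asym: "asymp_on X ?lt"
    unfolding asymp_on_def using Suc.prems(2) Q.le_antisym by (metis subsetD)
  have trans: "transp_on X ?lt"
  proof (rule transp_onI)
    fix x y z assume xyz: "x \<in> X" "y \<in> X" "z \<in> X" and lt: "?lt x y" "?lt y z"
    have "x \<in> carrier Q" "y \<in> carrier Q" "z \<in> carrier Q"
      using xyz Suc.prems(2) by auto
    then show "?lt x z"
      using lt Q.le_trans[of x y z] Q.le_antisym[of x y] by auto
  qed
  obtain m where m: "m \<in> X" "\<forall>x\<in>X. x \<noteq> m \<longrightarrow> \<not> ?lt m x"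
    using Finite_Set.bex_max_element[OF \<open>finite X\<close> asym trans \<open>X \<noteq> {}\<close>] by metis
  have "n = card (X - {m})" "finite (X - {m})" "X - {m} \<subseteq> carrier Q"
    using Suc.hyps(2) Suc.prems m(1) by auto
  then obtain f :: "'q \<Rightarrow> int" where
    f: "inj_on f (X - {m})" "\<forall>x\<in>X - {m}. \<forall>y\<in>X - {m}. le Q x y \<longrightarrow> f x \<le> f y"
    using Suc.hyps(1)[of "X - {m}"] by blast
  define k where "k = Max (insert 0 (f ` X)) + 1"
  have k: "f x < k" if "x \<in> X" for x
    using that Suc.prems(1) unfolding k_def
    by (meson Max_ge finite.insertI finite_imageI imageI insertI2 zle_add1_eq_le)
  have "inj_on (f(m := k)) X"
    using f(1) k by (auto simp: inj_on_def)
  moreover have "\<forall>x\<in>X. \<forall>y\<in>X. le Q x y \<longrightarrow> (f(m := k)) x \<le> (f(m := k)) y"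
    using f(2) k m(2) by (auto intro: less_imp_le)
  ultimately show ?case by blast
qed

lemma partial_order_int: "partial_order int_order"
  by (rule partial_orderI) auto

lemma order_congruences_eq_int:
  assumes "finite (carrier P)"
  shows "order_congruences P =
    {level_set_partition P int_order \<phi> | \<phi>. order_preserving_map P int_order \<phi>}"
    (is "_ = ?Z")
proof
  show "?Z \<subseteq> order_congruences P"
    using level_set_partition_in_order_congruences by blast
  show "order_congruences P \<subseteq> ?Z"
  proof
    fix \<pi> assume "\<pi> \<in> order_congruences P"
    then obtain Q :: "'a set gorder" and \<phi> where
      Q: "order_preserving_map P Q \<phi>" "\<pi> = level_set_partition P Q \<phi>"
      unfolding order_congruences_def by blast
    have "partial_order Q" "finite (\<phi> ` carrier P)" "\<phi> ` carrier P \<subseteq> carrier Q"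
      using Q(1) assms by (auto simp: order_preserving_map_def)
    from linear_extension[OF this] obtain f :: "'a set \<Rightarrow> int" where
      f: "inj_on f (\<phi> ` carrier P)"
         "\<forall>x\<in>\<phi> ` carrier P. \<forall>y\<in>\<phi> ` carrier P. le Q x y \<longrightarrow> f x \<le> f y"
      by blast
    have "order_preserving_map P int_order (f \<circ> \<phi>)"
      using Q(1) f(2) order_preserving_mapD[OF Q(1)] partial_order_int
      by (intro order_preserving_mapI) (auto simp: order_preserving_map_def)
    moreover have "\<pi> = level_set_partition P int_order (f \<circ> \<phi>)"
      unfolding Q(2) using Q(1) f(1)
      by (intro level_set_partition_cong) (auto simp: order_preserving_map_def inj_on_def)
    ultimately show "\<pi> \<in> ?Z" by blast
  qed
qed

lemma bottom_order_congruence_lattice: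
  assumes "partial_order P"
  shows "least (order_congruence_lattice P) ((\<lambda>p. {p}) ` carrier P)
           (carrier (order_congruence_lattice P))"
proof -
  have id: "order_preserving_map P P (\<lambda>p. p)"
    using assms by (auto intro: order_preserving_mapI)
  have eq: "level_set_partition P P (\<lambda>p. p) = (\<lambda>p. {p}) ` carrier P"
    by (subst level_set_partition_eq) auto
  have part: "partition_on (carrier P) \<pi>" if "\<pi> \<in> order_congruences P" for \<pi>
    using that partition_on_level_set_partition
    by (fastforce simp: order_congruences_def order_preserving_map_def)
  have mem: "(\<lambda>p. {p}) ` carrier P \<in> order_congruences P"
    using level_set_partition_in_order_congruences[OF id] eq by simp
  have "refines (carrier P) ((\<lambda>p. {p}) ` carrier P) \<pi>" if "\<pi> \<in> order_congruences P" for \<pi>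
    using part[OF that] part[OF mem] by (auto simp: refines_def partition_on_def)
  then show ?thesis
    using mem by (auto simp: least_def order_congruence_lattice_def)
qed

lemma maximal_chain_iff:
  assumes "partial_order L" "x \<in> carrier L" "y \<in> carrier L" "le L x y"
  shows "maximal_chain L x y c \<longleftrightarrow>
    sorted_wrt (\<lambda>a b. a \<sqsubset>\<^bsub>L\<^esub> b) c \<and> set c \<subseteq> \<lbrace>x..y\<rbrace>\<^bsub>L\<^esub> \<and>
    (\<forall>z\<in>\<lbrace>x..y\<rbrace>\<^bsub>L\<^esub>. (\<forall>w\<in>set c. le L z w \<or> le L w z) \<longrightarrow> z \<in> set c)"
    (is "_ \<longleftrightarrow> ?R x c")
proof
  interpret L: partial_order L by fact
  note less = L.lless_eq
  note int = at_least_at_most_def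
  show "?R x c" if "maximal_chain L x y c"
    using that
  proof (induction c arbitrary: x)
    case Nil
    then show ?case by (simp add: maximal_chain_def)
  next
    case (Cons a cs)
    show ?case
    proof (cases cs)
      case Nil
      with Cons.prems show ?thesis
        by (auto simp: maximal_chain_def int)
    next
      case (Cons b ds)
      have a: "a = x" and cov: "covers L x b" and b: "maximal_chain L b y cs"
        using Cons.prems Cons by (auto simp: maximal_chain_def)
      have ab: "x \<in> carrier L" "b \<in> carrier L" "le L x b" "x \<noteq> b"
        using cov by (auto simp: covers_def less)
      note IH = Cons.IH[OF b]
      have up: "w \<in> carrier L \<and> le L b w \<and> le L x w \<and> x \<noteq> w \<and> le L w y" if "w \<in> set cs" for w
        using IH that ab L.le_trans[of x b w] L.le_antisym[of x b] by (auto simp: int)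
      have xy: "le L x y"
        using up[of b] Cons Cons.prems ab L.le_trans[of x b y]
        by (metis last_in_set list.set_intros(1) maximal_chain_def subsetD)
      have "z \<in> set (a # cs)"
        if z: "z \<in> \<lbrace>x..y\<rbrace>\<^bsub>L\<^esub>" "\<forall>w\<in>set (a # cs). le L z w \<or> le L w z" for z
      proof (cases "le L b z")
        case True
        then show ?thesis using IH z by (auto simp: int)
      next
        case False
        then have "le L z b" "z \<noteq> b"
          using z ab Cons by auto
        then have "z = x"
          using cov z by (auto simp: covers_def less int)
        then show ?thesis by (simp add: a)
      qed
      moreover have "sorted_wrt (\<lambda>a b. a \<sqsubset>\<^bsub>L\<^esub> b) (a # cs)"
        using IH up by (auto simp: a less)
      moreover have "set (a # cs) \<subseteq> \<lbrace>x..y\<rbrace>\<^bsub>L\<^esub>"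
        using up ab xy by (auto simp: a int)
      ultimately show ?thesis by blast
    qed
  qed
  show "maximal_chain L x y c" if "?R x c"
    using that assms(2,4)
  proof (induction c arbitrary: x)
    case Nil
    then show ?case
      by (auto simp: int)
  next
    case (Cons a cs)
    have ai: "a \<in> carrier L" "le L x a" "le L a y"
      using Cons.prems by (auto simp: int)
    have csi: "w \<in> carrier L \<and> le L x w \<and> le L w y \<and> le L a w \<and> a \<noteq> w" if "w \<in> set cs" for w
      using Cons.prems that by (auto simp: int less)
    have max: "z \<in> set (a # cs)"
      if "z \<in> \<lbrace>x..y\<rbrace>\<^bsub>L\<^esub>" "\<forall>w\<in>set (a # cs). le L z w \<or> le L w z" for z
      using Cons.prems(1) that by blast
    have "x \<in> set (a # cs)"
      using ai csi Cons.prems by (intro max) (auto simp: int)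
    then have a: "a = x"
      using ai csi Cons.prems L.le_antisym by auto
    show ?case
    proof (cases cs)
      case Nil
      have "y \<in> set (a # cs)"
        using ai Nil assms(3) by (intro max) (auto simp: int a)
      then show ?thesis
        using Nil ai by (auto simp: maximal_chain_def a)
    next
      case (Cons b ds)
      have b: "b \<in> carrier L" "le L x b" "x \<noteq> b" "le L b y"
        using csi[of b] Cons by (auto simp: a)
      have bw: "le L b w" if "w \<in> set cs" for w
        using that Cons.prems(1) b by (auto simp: less Cons)
      have sub: "set cs \<subseteq> \<lbrace>b..y\<rbrace>\<^bsub>L\<^esub>"
        using bw csi by (auto simp: int)
      have mb: "z \<in> set cs"
        if z: "z \<in> \<lbrace>b..y\<rbrace>\<^bsub>L\<^esub>" "\<forall>w\<in>set cs. le L z w \<or> le L w z" for z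
      proof -
        have xz: "le L x z" "z \<in> carrier L" "x \<noteq> z"
          using z b ai a L.le_trans[of x b z] L.le_antisym[of x b] by (auto simp: int)
        then have "z \<in> set (a # cs)"
          using z by (intro max) (auto simp: int a)
        then show ?thesis using xz by (simp add: a)
      qed
      have "maximal_chain L b y cs"
        using Cons.prems(1) sub mb b by (intro Cons.IH) auto
      moreover have "covers L x b"
        unfolding covers_def
      proof (intro conjI notI)
        assume "\<exists>z\<in>carrier L. x \<sqsubset>\<^bsub>L\<^esub> z \<and> z \<sqsubset>\<^bsub>L\<^esub> b"
        then obtain z where z: "z \<in> carrier L" "le L x z" "x \<noteq> z" "le L z b" "z \<noteq> b"
          by (auto simp: less)
        have "z \<in> set (a # cs)"
        proof (rule max)
          show "z \<in> \<lbrace>x..y\<rbrace>\<^bsub>L\<^esub>"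
            using z b assms(3) L.le_trans[of z b y] by (auto simp: int)
          show "\<forall>w\<in>set (a # cs). le L z w \<or> le L w z"
            using z b bw csi L.le_trans[of z b] by (auto simp: a)
        qed
        then have "le L b z"
          using z bw by (auto simp: a)
        then show False
          using z b L.le_antisym by blast
      qed (use b ai a in \<open>auto simp: less\<close>)
      ultimately show ?thesis
        using ai Cons by (auto simp: maximal_chain_def a)
    qed
  qed
qed

end

theory Submission
  imports Defs
begin

text \<open>
  A finite comodernistic lattice is labeled as follows. A root ending in \<open>x\<close> carries a chain
  \<open>\<top> = t\<^sub>0 > t\<^sub>1 > \<dots> > t\<^sub>n = x\<close> in which each \<open>t\<^sub>i\<^sub>+\<^sub>1\<close> is a left-modular coatom of \<open>[x, t\<^sub>i]\<close>, and a cover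
  \<open>a\<close> of \<open>x\<close> is labeled by minus the number of \<open>t\<^sub>i\<close> above it. Left modularity makes \<open>t\<^sub>j \<sqinter> y\<close>, for
  the largest \<open>j\<close> with \<open>t\<^sub>j \<sqinter> y \<noteq> x\<close>, the only cover of \<open>x\<close> below \<open>y\<close> with the least label. Since the
  chain of \<open>a\<close> extends the part above \<open>a\<close> of the chain of \<open>x\<close>, the next label exceeds that of \<open>a\<close>
  exactly if the next element is not below the lowest \<open>t\<^sub>i\<close> above \<open>a\<close>. So the greedy chain
  is increasing and every other chain has a descent.

  In an interval \<open>[\<pi>, \<sigma>]\<close> of order congruences, a left-modular coatom is obtained from \<open>\<sigma>\<close> by
  splitting off, from a block of \<open>\<sigma>\<close> that contains several blocks of \<open>\<pi>\<close>, the topmost one of these.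
\<close>

section \<open>Left-modular coatoms of intervals\<close>

context lattice
begin

text \<open>Intervals are closed under join and meet, so using the operations of \<open>L\<close>
  agrees with left modularity in \<open>interval L u v\<close>
  (\<open>left_modular_coatom_interval_iff\<close>) and lets intervals with different bottoms be
  compared.\<close>

definition lm_coatom :: "'a \<Rightarrow> 'a \<Rightarrow> 'a \<Rightarrow> bool" where
  "lm_coatom u v m \<longleftrightarrow> u \<sqsubseteq> m \<and> covers L m v \<and>
     (\<forall>x\<in>\<lbrace>u..v\<rbrace>. \<forall>y\<in>\<lbrace>u..v\<rbrace>. x \<sqsubset> y \<longrightarrow> (x \<squnion> m) \<sqinter> y = x \<squnion> (m \<sqinter> y))"

lemma partial_order_interval: "partial_order (interval L u v)"
  by (rule partial_orderI)
     (auto simp: interval_def eq_is_equal at_least_at_most_def intro: le_trans)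

lemma join_interval:
  assumes "u \<in> carrier L" "v \<in> carrier L" "x \<in> \<lbrace>u..v\<rbrace>" "y \<in> \<lbrace>u..v\<rbrace>"
  shows "x \<squnion>\<^bsub>interval L u v\<^esub> y = x \<squnion> y"
proof -
  interpret I: partial_order "interval L u v" by (rule partial_order_interval)
  have xy: "x \<in> carrier L" "y \<in> carrier L" "u \<sqsubseteq> x" "x \<sqsubseteq> v" "y \<sqsubseteq> v"
    using assms by (auto simp: at_least_at_most_def)
  have ux: "u \<sqsubseteq> x \<squnion> y"
    using xy assms join_left[of x y] le_trans[of u x "x \<squnion> y"] by simp
  have "least (interval L u v) (x \<squnion> y) (Upper (interval L u v) {x, y})"
    using xy ux assms join_left[of x y] join_right[of x y] join_le[of x v y]
    by (auto simp: least_def Upper_def interval_def at_least_at_most_def intro: join_le)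
  then show ?thesis
    unfolding join_def[of "interval L u v"] Lattice.sup_def
    by (metis (mono_tags, lifting) I.least_unique someI)
qed

lemma meet_interval:
  assumes "u \<in> carrier L" "v \<in> carrier L" "x \<in> \<lbrace>u..v\<rbrace>" "y \<in> \<lbrace>u..v\<rbrace>"
  shows "x \<sqinter>\<^bsub>interval L u v\<^esub> y = x \<sqinter> y"
proof -
  interpret I: partial_order "interval L u v" by (rule partial_order_interval)
  have xy: "x \<in> carrier L" "y \<in> carrier L" "u \<sqsubseteq> x" "u \<sqsubseteq> y" "x \<sqsubseteq> v" "y \<sqsubseteq> v"
    using assms by (auto simp: at_least_at_most_def)
  have xv: "x \<sqinter> y \<sqsubseteq> v"
    using xy assms meet_left[of x y] le_trans[of "x \<sqinter> y" x v] by simp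
  have "greatest (interval L u v) (x \<sqinter> y) (Lower (interval L u v) {x, y})"
    using xy xv assms meet_left[of x y] meet_right[of x y] meet_le[of u x y]
    by (auto simp: greatest_def Lower_def interval_def at_least_at_most_def intro: meet_le)
  then show ?thesis
    unfolding meet_def[of "interval L u v"] Lattice.inf_def
    by (metis (mono_tags, lifting) I.greatest_unique someI)
qed

lemma top_interval:
  assumes "u \<in> carrier L" "v \<in> carrier L" "u \<sqsubseteq> v"
  shows "\<top>\<^bsub>interval L u v\<^esub> = v"
proof -
  interpret I: partial_order "interval L u v" by (rule partial_order_interval)
  have "greatest (interval L u v) v (carrier (interval L u v))"
    using assms by (auto simp: greatest_def interval_def at_least_at_most_def)
  then show ?thesis
    unfolding top_def by (metis (mono_tags, lifting) I.greatest_unique someI)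
qed

lemma coatom_interval_iff:
  assumes "u \<in> carrier L" "v \<in> carrier L" "u \<sqsubseteq> v"
  shows "coatom (interval L u v) m \<longleftrightarrow> u \<sqsubseteq> m \<and> covers L m v"
proof -
  have less: "x \<sqsubset>\<^bsub>interval L u v\<^esub> y \<longleftrightarrow> x \<sqsubset> y" for x y
    by (simp add: interval_def lless_def)
  show ?thesis
    using assms unfolding coatom_def top_interval[OF assms] covers_def less
    by (auto simp: interval_def at_least_at_most_def lless_eq intro: le_trans)
qed

lemma left_modular_coatom_interval_iff:
  assumes "u \<in> carrier L" "v \<in> carrier L" "u \<sqsubseteq> v"
  shows "coatom (interval L u v) m \<and> left_modular (interval L u v) m \<longleftrightarrow> lm_coatom u v m"
proof -
  have less: "x \<sqsubset>\<^bsub>interval L u v\<^esub> y \<longleftrightarrow> x \<sqsubset> y" for x y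
    by (simp add: interval_def lless_def)
  have carr: "carrier (interval L u v) = \<lbrace>u..v\<rbrace>"
    by (simp add: interval_def)
  have closed: "x \<squnion> y \<in> \<lbrace>u..v\<rbrace>" "x \<sqinter> y \<in> \<lbrace>u..v\<rbrace>" if "x \<in> \<lbrace>u..v\<rbrace>" "y \<in> \<lbrace>u..v\<rbrace>" for x y
  proof -
    have xy: "x \<in> carrier L" "y \<in> carrier L" "u \<sqsubseteq> x" "u \<sqsubseteq> y" "x \<sqsubseteq> v" "y \<sqsubseteq> v"
      using that by (auto simp: at_least_at_most_def)
    show "x \<squnion> y \<in> \<lbrace>u..v\<rbrace>"
      using xy assms join_left[of x y] le_trans[of u x "x \<squnion> y"]
      by (auto simp: at_least_at_most_def intro: join_le)
    show "x \<sqinter> y \<in> \<lbrace>u..v\<rbrace>"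
      using xy assms meet_left[of x y] le_trans[of "x \<sqinter> y" x v]
      by (auto simp: at_least_at_most_def intro: meet_le)
  qed
  have mem: "m \<in> \<lbrace>u..v\<rbrace>" if "u \<sqsubseteq> m" "covers L m v"
    using that by (auto simp: covers_def at_least_at_most_def lless_eq)
  show ?thesis
    unfolding coatom_interval_iff[OF assms] left_modular_def lm_coatom_def carr less
    using mem by (auto simp: join_interval[OF assms(1,2)] meet_interval[OF assms(1,2)] closed)
qed

text \<open>Raising the bottom only shrinks the set of pairs to be tested. This lets a chain of
  left-modular coatoms survive when the root moves up.\<close>

lemma lm_coatom_mono:
  assumes "lm_coatom u v m" "u \<in> carrier L" "a \<in> carrier L" "u \<sqsubseteq> a" "a \<sqsubseteq> m"
  shows "lm_coatom a v m"
proof -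
  have "\<lbrace>a..v\<rbrace> \<subseteq> \<lbrace>u..v\<rbrace>"
    using assms by (auto simp: at_least_at_most_def intro: le_trans)
  then show ?thesis
    using assms by (auto simp: lm_coatom_def)
qed

text \<open>
  If \<open>y\<close> meets a left-modular coatom in the bottom, then every \<open>z\<close> strictly between the bottom and
  \<open>y\<close> would satisfy \<open>y = (z \<squnion> m) \<sqinter> y = z \<squnion> (m \<sqinter> y) = z\<close>.
\<close>

lemma covers_if_meet_lm_coatom_eq_bottom:
  assumes m: "lm_coatom u v m"
    and u: "u \<in> carrier L" and y: "y \<in> carrier L" "u \<sqsubset> y" "y \<sqsubseteq> v" "m \<sqinter> y = u"
  shows "covers L u y"
  unfolding covers_def
proof (intro conjI notI u y)
  assume "\<exists>z\<in>carrier L. u \<sqsubset> z \<and> z \<sqsubset> y"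
  then obtain z where z: "z \<in> carrier L" "u \<sqsubseteq> z" "u \<noteq> z" "z \<sqsubseteq> y" "z \<noteq> y"
    by (auto simp: lless_eq)
  have mv: "m \<in> carrier L" "v \<in> carrier L" "m \<sqsubseteq> v" "u \<sqsubseteq> m"
    using m by (auto simp: lm_coatom_def covers_def lless_eq)
  have zv: "z \<sqsubseteq> v"
    using z y mv le_trans by blast
  \<comment> \<open>Otherwise \<open>z \<sqsubseteq> m \<sqinter> y = u\<close>. So \<open>z\<close>
    and the coatom \<open>m\<close> join to \<open>v\<close>.\<close>
  have "\<not> z \<sqsubseteq> m"
    using z y mv u meet_le[of z m y] le_antisym[of u z] by auto
  then have "z \<squnion> m \<noteq> m"
    using z mv join_left by metis
  moreover have "m \<sqsubseteq> z \<squnion> m" "z \<squnion> m \<sqsubseteq> v" "z \<squnion> m \<in> carrier L"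
    using z mv zv by (auto intro: join_right join_le)
  ultimately have "z \<squnion> m = v"
    using m by (auto simp: lm_coatom_def covers_def lless_eq)
  moreover have "(z \<squnion> m) \<sqinter> y = z \<squnion> (m \<sqinter> y)"
    using m z y u zv unfolding lm_coatom_def by (auto simp: lless_eq at_least_at_most_def)
  moreover have "v \<sqinter> y = y"
    using y mv le_iff_join[of y v] by (simp add: meet_comm)
  moreover have "z \<squnion> u = z"
    using z u le_iff_meet[of u z] by (simp add: join_comm)
  ultimately show False
    using z y by simp
qed

end


section \<open>Finite comodernistic lattices are CL-shellable\<close>

locale finite_comodernistic_lattice = lattice +
  assumes finite_carrier: "finite (carrier L)"
    and carrier_nonempty: "carrier L \<noteq> {}"
    and ex_lm_coatom: "\<lbrakk>u \<in> carrier L; v \<in> carrier L; u \<sqsubset> v\<rbrakk> \<Longrightarrow> \<exists>m. lm_coatom u v m"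
begin

lemma top_greatest: "greatest L \<top> (carrier L)"
proof -
  have "least L (\<Squnion>(carrier L)) (Upper L (carrier L))"
    using finite_carrier carrier_nonempty by (intro finite_sup_least) auto
  then have "greatest L (\<Squnion>(carrier L)) (carrier L)"
    by (auto simp: greatest_def least_def Upper_def)
  then show ?thesis
    unfolding top_def by (rule someI)
qed

lemma top_carrier: "\<top> \<in> carrier L" and le_top: "x \<in> carrier L \<Longrightarrow> x \<sqsubseteq> \<top>"
  using top_greatest by (auto simp: greatest_def)

lemma ex_cover_below:
  assumes "x \<in> carrier L" "y \<in> carrier L" "x \<sqsubset> y"
  shows "\<exists>z. covers L x z \<and> z \<sqsubseteq> y"
  using assms(2,3)
proof (induction "card \<lbrace>x..y\<rbrace>" arbitrary: y rule: less_induct)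
  case less
  show ?case
  proof (cases "covers L x y")
    case False
    then obtain w where w: "w \<in> carrier L" "x \<sqsubset> w" "w \<sqsubset> y"
      using less.prems assms(1) by (auto simp: covers_def)
    then have "\<lbrace>x..w\<rbrace> \<subset> \<lbrace>x..y\<rbrace>"
      using less.prems by (auto simp: at_least_at_most_def lless_eq intro: le_trans)
    then have "card \<lbrace>x..w\<rbrace> < card \<lbrace>x..y\<rbrace>"
      using finite_carrier by (intro psubset_card_mono) (auto simp: at_least_at_most_def)
    then obtain z where "covers L x z" "z \<sqsubseteq> w"
      using less.hyps w by blast
    then show ?thesis
      using w less.prems le_trans[of z w y] by (auto simp: lless_eq covers_def)
  qed (use less.prems in auto)
qed

lemma card_interval_less:
  assumes "covers L x a" "a \<sqsubseteq> y" "y \<in> carrier L"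
  shows "card \<lbrace>a..y\<rbrace> < card \<lbrace>x..y\<rbrace>"
proof -
  have a: "x \<in> carrier L" "a \<in> carrier L" "x \<sqsubseteq> a" "x \<noteq> a"
    using assms by (auto simp: covers_def lless_eq)
  have "x \<in> \<lbrace>x..y\<rbrace>" "x \<notin> \<lbrace>a..y\<rbrace>"
    using a assms le_trans[of x a y] le_antisym[of x a] by (auto simp: at_least_at_most_def)
  moreover have "\<lbrace>a..y\<rbrace> \<subseteq> \<lbrace>x..y\<rbrace>"
    using a assms by (auto simp: at_least_at_most_def intro: le_trans)
  ultimately show ?thesis
    using finite_carrier by (intro psubset_card_mono) (auto simp: at_least_at_most_def)
qed

section \<open>Maximal chains\<close>

lemma maximal_chain_Cons:
  assumes "covers L x a" "maximal_chain L a y c"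
  shows "maximal_chain L x y (x # c)"
  using assms by (auto simp: maximal_chain_def successively_Cons covers_def)

lemma maximal_chainE:
  assumes "maximal_chain L x y c" "x \<noteq> y"
  obtains a c' where "c = x # a # c'" "covers L x a" "maximal_chain L a y (a # c')"
proof -
  obtain a c' where "c = x # a # c'"
    using assms by (cases c rule: remdups_adj.cases) (auto simp: maximal_chain_def)
  with assms that show ?thesis
    by (auto simp: maximal_chain_def)
qed

lemma maximal_chain_hd: "maximal_chain L a y c \<Longrightarrow> c = a # tl c"
  by (cases c) (auto simp: maximal_chain_def)

lemma maximal_chain_le:
  assumes "maximal_chain L x y c"
  shows "x \<sqsubseteq> y"
  using assms
proof (induction c arbitrary: x)
  case (Cons b c)
  show ?case
  proof (cases "x = y")
    case True
    then show ?thesis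
      using Cons.prems by (auto simp: maximal_chain_def)
  next
    case False
    obtain a c' where a: "b # c = x # a # c'" "covers L x a" "maximal_chain L a y (a # c')"
      using maximal_chainE[OF Cons.prems False] by metis
    then have "a \<sqsubseteq> y"
      using Cons.IH by simp
    moreover have "y \<in> carrier L"
      using a(3) last_in_set[of "a # c'"] by (auto simp: maximal_chain_def)
    ultimately show ?thesis
      using a(2) le_trans[of x a y] by (auto simp: covers_def lless_eq)
  qed
qed (simp add: maximal_chain_def)

lemma maximal_chain_refl:
  assumes "maximal_chain L x x c"
  shows "c = [x]"
proof (rule ccontr)
  assume "c \<noteq> [x]"
  then obtain a c' where c: "c = x # a # c'"
    using assms by (cases c rule: remdups_adj.cases) (auto simp: maximal_chain_def)
  then have "covers L x a" "maximal_chain L a x (a # c')"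
    using assms by (auto simp: maximal_chain_def)
  then show False
    using maximal_chain_le[of a x] le_antisym[of x a] by (auto simp: covers_def lless_eq)
qed

lemma ex_maximal_chain:
  assumes "x \<in> carrier L" "y \<in> carrier L" "x \<sqsubseteq> y"
  shows "\<exists>c. maximal_chain L x y c"
  using assms(1,3)
proof (induction "card \<lbrace>x..y\<rbrace>" arbitrary: x rule: less_induct)
  case less
  show ?case
  proof (cases "x = y")
    case True
    then have "maximal_chain L x y [x]"
      using less.prems by (simp add: maximal_chain_def)
    then show ?thesis ..
  next
    case False
    then obtain z where z: "covers L x z" "z \<sqsubseteq> y"
      using ex_cover_below[of x y] less.prems assms(2) by (auto simp: lless_eq)
    then have "\<exists>c. maximal_chain L z y c"
      using less.hyps card_interval_less assms(2) by (auto simp: covers_def)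
    then show ?thesis
      using maximal_chain_Cons z by blast
  qed
qed

section \<open>Descending chains of left-modular coatoms\<close>

text \<open>The last entry may lie strictly above \<open>x\<close>, so that the truncations made
  when the root moves up are chains again; reaching \<open>x\<close> is stated separately.\<close>

definition lm_chain :: "'a \<Rightarrow> 'a list \<Rightarrow> bool" where
  "lm_chain x ts \<longleftrightarrow> ts \<noteq> [] \<and> hd ts = \<top> \<and> (\<forall>t\<in>set ts. t \<in> carrier L \<and> x \<sqsubseteq> t) \<and>
     sorted_wrt (\<lambda>s t. t \<sqsubseteq> s) ts \<and> successively (lm_coatom x) ts"

text \<open>A left-modular coatom of \<open>[x, last ts]\<close> can be appended until
  \<open>x\<close> is reached, and this interval shrinks each time.\<close>

lemma ex_complete_lm_chain:
  assumes "x \<in> carrier L" "lm_chain x ts"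
  shows "\<exists>us. lm_chain x (ts @ us) \<and> last (ts @ us) = x"
  using assms(2)
proof (induction "card \<lbrace>x..last ts\<rbrace>" arbitrary: ts rule: less_induct)
  case less
  show ?case
  proof (cases "last ts = x")
    case True
    with less.prems show ?thesis
      by (intro exI[of _ "[]"]) simp
  next
    case False
    have ts: "ts \<noteq> []" "last ts \<in> carrier L" "x \<sqsubseteq> last ts"
      using less.prems last_in_set[of ts] by (auto simp: lm_chain_def)
    obtain m where m: "lm_coatom x (last ts) m"
      using ex_lm_coatom[of x "last ts"] ts False assms(1) by (auto simp: lless_eq)
    then have mt: "m \<in> carrier L" "x \<sqsubseteq> m" "m \<sqsubseteq> last ts" "m \<noteq> last ts"
      by (auto simp: lm_coatom_def covers_def lless_eq)
    have "\<forall>t\<in>set ts. last ts \<sqsubseteq> t"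
      using less.prems ts by (induction ts rule: rev_induct) (auto simp: lm_chain_def sorted_wrt_append)
    then have "\<forall>t\<in>set ts. m \<sqsubseteq> t"
      using mt ts less.prems le_trans[of m "last ts"] by (auto simp: lm_chain_def)
    then have chain: "lm_chain x (ts @ [m])"
      using less.prems m mt ts
      by (auto simp: lm_chain_def sorted_wrt_append successively_append_iff)
    have "last ts \<in> \<lbrace>x..last ts\<rbrace>" "last ts \<notin> \<lbrace>x..m\<rbrace>" "\<lbrace>x..m\<rbrace> \<subseteq> \<lbrace>x..last ts\<rbrace>"
      using mt ts le_antisym[of m "last ts"] by (auto simp: at_least_at_most_def intro: le_trans)
    then have "card \<lbrace>x..m\<rbrace> < card \<lbrace>x..last ts\<rbrace>"
      using finite_carrier by (intro psubset_card_mono) (auto simp: at_least_at_most_def)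
    then obtain us where "lm_chain x ((ts @ [m]) @ us)" "last ((ts @ [m]) @ us) = x"
      using less.hyps[of "ts @ [m]"] chain by auto
    then show ?thesis
      by (intro exI[of _ "m # us"]) simp
  qed
qed

lemma filter_eq_takeWhile:
  assumes "sorted_wrt (\<lambda>s t. t \<sqsubseteq> s) ts" "set ts \<subseteq> carrier L" "a \<in> carrier L"
  shows "filter (\<lambda>t. a \<sqsubseteq> t) ts = takeWhile (\<lambda>t. a \<sqsubseteq> t) ts"
  using assms
proof (induction ts)
  case (Cons s ts)
  show ?case
  proof (cases "a \<sqsubseteq> s")
    case False
    then have "\<not> a \<sqsubseteq> t" if "t \<in> set ts" for t
      using that Cons.prems le_trans[of a t s] by auto
    then show ?thesis
      using False by (simp add: filter_empty_conv)
  qed (use Cons in simp)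
qed simp

text \<open>In a descending list the entries above \<open>a\<close> form a prefix, so neighbours in
  the filtered list were neighbours before; \<open>lm_coatom_mono\<close> then moves the bottom to
  \<open>a\<close>.\<close>

lemma lm_chain_filter:
  assumes ts: "lm_chain x ts" and xa: "x \<in> carrier L" "a \<in> carrier L" "x \<sqsubseteq> a"
  shows "lm_chain a (filter (\<lambda>t. a \<sqsubseteq> t) ts)"
proof -
  let ?U = "filter (\<lambda>t. a \<sqsubseteq> t) ts"
  have U: "?U = takeWhile (\<lambda>t. a \<sqsubseteq> t) ts"
    using ts xa by (intro filter_eq_takeWhile) (auto simp: lm_chain_def)
  obtain ts' where ts': "ts = \<top> # ts'"
    using ts by (cases ts) (auto simp: lm_chain_def)
  have "successively (lm_coatom x) (?U @ dropWhile (\<lambda>t. a \<sqsubseteq> t) ts)"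
    unfolding U takeWhile_dropWhile_id using ts by (simp add: lm_chain_def)
  then have "successively (lm_coatom x) ?U"
    by (simp add: successively_append_iff)
  then have "successively (lm_coatom a) ?U"
    by (rule successively_mono) (use xa in \<open>auto intro: lm_coatom_mono\<close>)
  moreover have "?U \<noteq> []" "hd ?U = \<top>"
    using le_top xa by (auto simp: ts')
  ultimately show ?thesis
    using ts by (auto simp: lm_chain_def sorted_wrt_filter)
qed

text \<open>
  The chain guiding the labels after the root has moved up to \<open>a\<close>: the part above \<open>a\<close> is kept, so
  that labels of later covers can be compared with that of \<open>a\<close>; below it, any left-modular
  continuation down to \<open>a\<close> will do.
\<close>

definition next_chain :: "'a list \<Rightarrow> 'a \<Rightarrow> 'a list" where
  "next_chain ts a = (let U = filter (\<lambda>t. a \<sqsubseteq> t) ts in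
     U @ (SOME us. lm_chain a (U @ us) \<and> last (U @ us) = a))"

text \<open>\<open>[\<top>]\<close> is a chain for every bottom element; the first step of the fold,
  at the first element of the root, completes it down to that element.\<close>

definition root_chain :: "'a list \<Rightarrow> 'a list" where
  "root_chain r = foldl next_chain [\<top>] r"

text \<open>
  Counting from the top makes labels comparable across roots, whose chains share an upper part but
  may have different lengths.
\<close>

definition lab :: "'a rooted_labeling" where
  "lab r y = - int (length (filter (\<lambda>t. y \<sqsubseteq> t) (root_chain r)))"

lemma next_chain:
  assumes "lm_chain x ts" "x \<in> carrier L" "a \<in> carrier L" "x \<sqsubseteq> a"
  shows "lm_chain a (next_chain ts a)" "last (next_chain ts a) = a"
    and "\<exists>us. next_chain ts a = filter (\<lambda>t. a \<sqsubseteq> t) ts @ us"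
  using someI_ex[OF ex_complete_lm_chain[OF assms(3) lm_chain_filter[OF assms]]]
  by (simp_all add: next_chain_def Let_def)

section \<open>Roots and their labels\<close>

definition root :: "'a list \<Rightarrow> 'a \<Rightarrow> bool" where
  "root r x \<longleftrightarrow> r \<noteq> [] \<and> last r = x \<and> set r \<subseteq> carrier L \<and> successively (covers L) r"

lemma root_snoc:
  assumes "root r x" "covers L x a"
  shows "root (r @ [a]) a"
  using assms by (auto simp: root_def successively_append_iff covers_def)

lemma root_chain:
  assumes "root r x"
  shows "lm_chain x (root_chain r) \<and> last (root_chain r) = x"
  using assms
proof (induction r arbitrary: x rule: rev_induct)
  case (snoc a r)
  have a: "a = x" "x \<in> carrier L"
    using snoc.prems by (auto simp: root_def)
  show ?case
  proof (cases "r = []")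
    case True
    have "lm_chain x [\<top>]"
      using a top_carrier le_top by (simp add: lm_chain_def)
    then show ?thesis
      using next_chain[of x "[\<top>]" x] a True by (simp add: root_chain_def)
  next
    case False
    then have "root r (last r)" "covers L (last r) x"
      using snoc.prems a by (auto simp: root_def successively_append_iff)
    then show ?thesis
      using snoc.IH[of "last r"] next_chain[of "last r" "root_chain r" x] a
      by (auto simp: root_chain_def covers_def lless_eq)
  qed
qed (simp add: root_def)

text \<open>The entries \<open>?U\<close> above \<open>a\<close> remain the initial part of the new
  chain. If \<open>z\<close> is below the lowest of them, it is below all of \<open>?U\<close>, and
  its count is at least that of \<open>a\<close>. Otherwise that entry and all later ones, which lie
  below it, are lost and the count drops. Labels are negated counts.\<close>

lemma lab_next_le_iff:
  assumes r: "root r x" and xa: "covers L x a" and az: "covers L a z"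
  shows "lab (r @ [a]) z \<le> lab r a \<longleftrightarrow> z \<sqsubseteq> last (filter (\<lambda>t. a \<sqsubseteq> t) (root_chain r))"
proof -
  let ?U = "filter (\<lambda>t. a \<sqsubseteq> t) (root_chain r)"
  have carr: "x \<in> carrier L" "a \<in> carrier L" "z \<in> carrier L" "x \<sqsubseteq> a"
    using xa az by (auto simp: covers_def lless_eq)
  note ts = root_chain[OF r, THEN conjunct1]
  note U = lm_chain_filter[OF ts carr(1,2,4)]
  have Une: "?U \<noteq> []" "last ?U \<in> carrier L"
    using U last_in_set[of ?U] by (auto simp: lm_chain_def)
  obtain us where us: "root_chain (r @ [a]) = ?U @ us"
    using next_chain(3)[OF ts carr(1,2,4)] by (auto simp: root_chain_def)
  have chain: "lm_chain a (?U @ us)"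
    using next_chain(1)[OF ts carr(1,2,4)] us by (simp add: root_chain_def)
  have last_le: "last ?U \<sqsubseteq> s" if "s \<in> set ?U" for s
    using U that Une unfolding lm_chain_def
    by (cases ?U rule: rev_cases) (auto simp: sorted_wrt_append simp del: set_filter)
  have us_le: "s \<sqsubseteq> last ?U \<and> s \<in> carrier L" if "s \<in> set us" for s
    using chain that last_in_set[OF Une(1)] unfolding lm_chain_def sorted_wrt_append
    by (metis UnI2 set_append)
  have lab: "lab (r @ [a]) z = - int (length (filter (\<lambda>t. z \<sqsubseteq> t) ?U) + length (filter (\<lambda>t. z \<sqsubseteq> t) us))"
    unfolding lab_def us by simp
  have laba: "lab r a = - int (length ?U)"
    by (simp add: lab_def)
  show ?thesis
  proof
    assume "z \<sqsubseteq> last ?U"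
    then have "\<forall>s\<in>set ?U. z \<sqsubseteq> s"
      using last_le carr(3) Une(2) U le_trans[of z "last ?U"] unfolding lm_chain_def by blast
    then have "filter (\<lambda>t. z \<sqsubseteq> t) ?U = ?U"
      by (rule filter_True)
    then show "lab (r @ [a]) z \<le> lab r a"
      unfolding lab laba by simp
  next
    assume le: "lab (r @ [a]) z \<le> lab r a"
    show "z \<sqsubseteq> last ?U"
    proof (rule ccontr)
      assume z: "\<not> z \<sqsubseteq> last ?U"
      then have "filter (\<lambda>t. z \<sqsubseteq> t) us = []"
        using us_le carr(3) Une(2) le_trans[of z _ "last ?U"] unfolding filter_empty_conv by blast
      moreover have "length (filter (\<lambda>t. z \<sqsubseteq> t) ?U) < length ?U"
        using length_filter_less[OF last_in_set[OF Une(1)], of "\<lambda>t. z \<sqsubseteq> t"] z by simp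
      ultimately show False
        using le unfolding lab laba by simp
    qed
  qed
qed

text \<open>Let \<open>t\<close> be the last entry of the chain before the first one,
  \<open>t'\<close>, that meets \<open>y\<close> in \<open>x\<close>; then
  \<open>a = t \<sqinter> y\<close>. Every other cover \<open>b\<close> fails to be below
  \<open>t\<close>, hence has fewer entries above it. The last clause, placing \<open>a\<close>
  below the lowest entry above \<open>b\<close>, later yields the descent for chains through
  \<open>b\<close>.\<close>

lemma minimal_label:
  assumes r: "root r x" and y: "x \<in> carrier L" "y \<in> carrier L" "x \<sqsubset> y"
  obtains a where "covers L x a" "a \<sqsubseteq> y"
    and "last (filter (\<lambda>t. a \<sqsubseteq> t) (root_chain r)) \<sqinter> y = a"
    and "\<And>b. \<lbrakk>covers L x b; b \<sqsubseteq> y; b \<noteq> a\<rbrakk> \<Longrightarrow>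
           lab r a < lab r b \<and> a \<sqsubseteq> last (filter (\<lambda>t. b \<sqsubseteq> t) (root_chain r))"
proof -
  let ?ts = "root_chain r"
  define Q where "Q t \<longleftrightarrow> t \<sqinter> y \<noteq> x" for t
  have ts: "lm_chain x ?ts" "last ?ts = x"
    using root_chain[OF r] by auto
  have xy: "x \<sqsubseteq> y" "x \<noteq> y"
    using y by (auto simp: lless_eq)
  have "Q \<top>"
    using y le_top top_carrier le_iff_join[of y \<top>] xy by (auto simp: Q_def meet_comm)
  moreover have "\<not> Q x"
    using y le_iff_join[of x y] xy by (auto simp: Q_def)
  ultimately have ne: "takeWhile Q ?ts \<noteq> []" "dropWhile Q ?ts \<noteq> []"
    using ts last_in_set[of ?ts] by (cases ?ts; force simp: lm_chain_def dropWhile_eq_Nil_conv)+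
  obtain pre t where pre: "takeWhile Q ?ts = pre @ [t]"
    using ne by (cases "takeWhile Q ?ts" rule: rev_cases) auto
  obtain t' post where post: "dropWhile Q ?ts = t' # post"
    using ne by (cases "dropWhile Q ?ts") auto
  have split: "?ts = pre @ t # t' # post"
    using takeWhile_dropWhile_id[of Q ?ts] pre post by simp
  have "Q t"
    using set_takeWhileD[of t Q ?ts] pre by auto
  have "\<not> Q t'"
    using hd_dropWhile[OF ne(2)] post by simp
  have carr: "\<forall>s\<in>set ?ts. s \<in> carrier L \<and> x \<sqsubseteq> s" and lm: "lm_coatom x t t'"
    and sorted: "\<forall>s\<in>set pre. t \<sqsubseteq> s" "\<forall>s\<in>set post. s \<sqsubseteq> t'" "t' \<sqsubseteq> t"
    using ts(1) unfolding lm_chain_def split by (auto simp: sorted_wrt_append successively_append_iff)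
  have tc: "t \<in> carrier L" "t' \<in> carrier L" "x \<sqsubseteq> t" "x \<sqsubseteq> t'"
    using carr split by auto
  define a where "a = t \<sqinter> y"
  have a: "a \<in> carrier L" "a \<sqsubseteq> t" "a \<sqsubseteq> y" "x \<sqsubseteq> a" "x \<noteq> a"
    using tc y xy \<open>Q t\<close> unfolding a_def Q_def
    by (auto intro: meet_left meet_right meet_le)
  \<comment> \<open>Thus the left-modular coatom \<open>t'\<close> of \<open>[x, t]\<close> meets
    \<open>a\<close> in the bottom, which forces \<open>a\<close> to cover \<open>x\<close>.\<close>
  have "t' \<sqinter> a = x"
  proof (rule le_antisym)
    have "t' \<sqinter> a \<sqsubseteq> t'" "t' \<sqinter> a \<sqsubseteq> y"
      using a tc y meet_left[of t' a] meet_right[of t' a] le_trans[of "t' \<sqinter> a" a y] by auto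
    then show "t' \<sqinter> a \<sqsubseteq> x"
      using \<open>\<not> Q t'\<close> meet_le[of "t' \<sqinter> a" t' y] a tc y by (simp add: Q_def)
  qed (use a tc y in \<open>auto intro: meet_le\<close>)
  then have cov: "covers L x a"
    using lm y(1) a by (intro covers_if_meet_lm_coatom_eq_bottom) (auto simp: lless_eq)
  \<comment> \<open>A cover of \<open>x\<close> below both \<open>y\<close> and such an entry would
    lie below \<open>t' \<sqinter> y = x\<close>.\<close>
  have low: "\<not> b \<sqsubseteq> s" if b: "covers L x b" "b \<sqsubseteq> y" and s: "s = t' \<or> s \<in> set post" for b s
  proof
    assume "b \<sqsubseteq> s"
    have bc: "b \<in> carrier L" "x \<sqsubseteq> b" "x \<noteq> b"
      using b by (auto simp: covers_def lless_eq)
    have "b \<sqsubseteq> t'"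
      using \<open>b \<sqsubseteq> s\<close> s sorted carr split bc tc le_trans[of b s t'] by auto
    then have "b \<sqsubseteq> x"
      using \<open>\<not> Q t'\<close> meet_le[of b t' y] bc tc y b by (simp add: Q_def)
    then show False
      using bc y le_antisym[of x b] by auto
  qed
  have filter: "filter (\<lambda>s. b \<sqsubseteq> s) ?ts = filter (\<lambda>s. b \<sqsubseteq> s) (pre @ [t])"
    if "covers L x b" "b \<sqsubseteq> y" for b
    using low[OF that] unfolding split by (auto simp: filter_empty_conv)
  have apre: "\<forall>s\<in>set pre. a \<sqsubseteq> s"
    using sorted carr split a tc le_trans[of a t] by auto
  have fa: "filter (\<lambda>s. a \<sqsubseteq> s) ?ts = pre @ [t]"
    using filter[OF cov a(3)] apre a by simp
  show thesis
  proof (rule that[OF cov a(3)])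
    show "last (filter (\<lambda>t. a \<sqsubseteq> t) ?ts) \<sqinter> y = a"
      unfolding fa by (simp add: a_def)
    fix b assume b: "covers L x b" "b \<sqsubseteq> y" "b \<noteq> a"
    have bc: "b \<in> carrier L" "x \<sqsubseteq> b" "x \<noteq> b"
      using b by (auto simp: covers_def lless_eq)
    have "\<not> b \<sqsubseteq> t"
    proof
      assume "b \<sqsubseteq> t"
      then have "b \<sqsubseteq> a"
        using b bc tc y by (auto simp: a_def intro: meet_le)
      then show False
        using cov b bc by (auto simp: covers_def lless_eq)
    qed
    then have fb: "filter (\<lambda>s. b \<sqsubseteq> s) ?ts = filter (\<lambda>s. b \<sqsubseteq> s) pre"
      using filter[OF b(1,2)] by simp
    have "lab r a < lab r b"
      unfolding lab_def fa fb using length_filter_le[of "\<lambda>s. b \<sqsubseteq> s" pre]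
      by (simp del: length_filter_le)
    moreover have "filter (\<lambda>s. b \<sqsubseteq> s) pre \<noteq> []"
      using lm_chain_filter[OF ts(1) y(1) bc(1,2)] fb by (simp add: lm_chain_def)
    then have "last (filter (\<lambda>s. b \<sqsubseteq> s) pre) \<in> set pre"
      using last_in_set by fastforce
    ultimately show "lab r a < lab r b \<and> a \<sqsubseteq> last (filter (\<lambda>t. b \<sqsubseteq> t) ?ts)"
      using apre fb by simp
  qed
qed

section \<open>Increasing chains of rooted intervals\<close>

text \<open>The chain starts with the cover \<open>a\<close> from \<open>minimal_label\<close> and
  continues, by induction on the size of the interval, with the increasing chain from
  \<open>a\<close> to \<open>y\<close> rooted at \<open>r @ [a]\<close>.\<close>

lemma rooted_interval:
  assumes "root r x" "x \<in> carrier L" "y \<in> carrier L" "x \<sqsubseteq> y"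
  shows "\<exists>c. increasing_chain L lab r x y c \<and>
             (\<forall>d. increasing_chain L lab r x y d \<longrightarrow> d = c) \<and>
             (\<forall>d. maximal_chain L x y d \<and> d \<noteq> c \<longrightarrow>
                (label_word lab r (tl c), label_word lab r (tl d)) \<in> lexord {(a, b). a < b})"
    (is "\<exists>c. ?CL r x c")
  using assms(1,2,4)
proof (induction "card \<lbrace>x..y\<rbrace>" arbitrary: x r rule: less_induct)
  case less
  show ?case
  proof (cases "x = y")
    case True
    have x: "maximal_chain L x x [x]"
      using less.prems by (simp add: maximal_chain_def)
    show ?thesis
      unfolding True[symmetric] increasing_chain_def
    proof (intro exI[of _ "[x]"] conjI allI impI x)
      fix d
      show "d = [x]" if "maximal_chain L x x d \<and> sorted_wrt (<) (label_word lab r (tl d))"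
        using that maximal_chain_refl by blast
      show "(label_word lab r (tl [x]), label_word lab r (tl d)) \<in> lexord {(a, b). a < b}"
        if "maximal_chain L x x d \<and> d \<noteq> [x]"
        using that maximal_chain_refl by blast
    qed simp
  next
    case False
    have IH: "\<exists>c. ?CL (r @ [a]) a c" if "covers L x a" "a \<sqsubseteq> y" for a
      using that less.hyps[OF card_interval_less[OF that assms(3)] root_snoc[OF less.prems(1) that(1)]]
      by (auto simp: covers_def)
    obtain a where a: "covers L x a" "a \<sqsubseteq> y"
      and ay: "last (filter (\<lambda>t. a \<sqsubseteq> t) (root_chain r)) \<sqinter> y = a" (is "?ta \<sqinter> y = a")
      and amin: "\<And>b. \<lbrakk>covers L x b; b \<sqsubseteq> y; b \<noteq> a\<rbrakk> \<Longrightarrow>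
           lab r a < lab r b \<and> a \<sqsubseteq> last (filter (\<lambda>t. b \<sqsubseteq> t) (root_chain r))"
      using minimal_label[of r x y] less.prems assms(3) False by (auto simp: lless_eq)
    obtain c where c: "?CL (r @ [a]) a c"
      using IH[OF a] by blast
    have last_in: "last (filter (\<lambda>t. b \<sqsubseteq> t) (root_chain r)) \<in> carrier L \<and>
        b \<sqsubseteq> last (filter (\<lambda>t. b \<sqsubseteq> t) (root_chain r))" if "covers L x b" for b
    proof -
      have "lm_chain b (filter (\<lambda>t. b \<sqsubseteq> t) (root_chain r))"
        using root_chain[OF less.prems(1)] that
        by (intro lm_chain_filter[of x]) (auto simp: covers_def lless_eq)
      then show ?thesis
        using last_in_set[of "filter (\<lambda>t. b \<sqsubseteq> t) (root_chain r)"] by (auto simp: lm_chain_def)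
    qed
    have ac: "a \<in> carrier L"
      using a by (simp add: covers_def)
    have cmax: "maximal_chain L a y c" and cinc: "sorted_wrt (<) (label_word lab (r @ [a]) (tl c))"
      using c by (auto simp: increasing_chain_def)
    have ctl: "c = a # tl c"
      using maximal_chain_hd[OF cmax] .
    have word: "label_word lab r' d = lab r' b # label_word lab (r' @ [b]) (tl d)"
      if "maximal_chain L b y d" for r' b d
      using maximal_chain_hd[OF that] by (metis label_word.simps(2))
    have "maximal_chain L x y (x # c)"
      using maximal_chain_Cons[OF a(1) cmax] .
    moreover have "sorted_wrt (<) (label_word lab r c)"
    proof (cases "a = y")
      case True
      then have "c = [a]"
        using maximal_chain_refl cmax by simp
      then show ?thesis by simp
    next
      case False
      obtain z c' where z: "c = a # z # c'" "covers L a z" "maximal_chain L z y (z # c')"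
        using maximal_chainE[OF cmax False] by metis
      have zy: "z \<sqsubseteq> y" "z \<in> carrier L" "a \<sqsubseteq> z" "a \<noteq> z"
        using maximal_chain_le[OF z(3)] z(2) by (auto simp: covers_def lless_eq)
      \<comment> \<open>Otherwise \<open>z \<sqsubseteq> ?ta \<sqinter> y = a\<close>. Hence there
        is no descent at \<open>a\<close>; the later labels increase by induction.\<close>
      have "\<not> z \<sqsubseteq> ?ta"
        using zy meet_le[of z ?ta y] last_in[OF a(1)] assms(3) ay ac le_antisym[of a z] by auto
      then have "lab r a < lab (r @ [a]) z"
        using lab_next_le_iff[OF less.prems(1) a(1) z(2)] by simp
      then show ?thesis
        using cinc unfolding word[OF cmax] z(1) by auto
    qed
    ultimately have inc: "increasing_chain L lab r x y (x # c)"
      by (simp add: increasing_chain_def)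
    have uniq: "d = x # c" if d: "increasing_chain L lab r x y d" for d
    proof -
      have "maximal_chain L x y d"
        using d by (simp add: increasing_chain_def)
      then obtain b d' where b: "d = x # b # d'" "covers L x b" "maximal_chain L b y (b # d')"
        using maximal_chainE False by metis
      have by': "b \<sqsubseteq> y" "b \<in> carrier L"
        using maximal_chain_le[OF b(3)] b(2) by (auto simp: covers_def)
      have inc': "increasing_chain L lab (r @ [b]) b y (b # d')"
        and first: "\<forall>l\<in>set (label_word lab (r @ [b]) d'). lab r b < l"
        using d b by (auto simp: increasing_chain_def)
      show ?thesis
      proof (cases "b = a")
        case True
        then show ?thesis
          using c inc' b by blast
      next
        case ba: False
        let ?tb = "last (filter (\<lambda>t. b \<sqsubseteq> t) (root_chain r))"
        note tb = last_in[OF b(2)]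
        have a_tb: "a \<sqsubseteq> ?tb"
          using amin[OF b(2) by'(1) ba] by simp
        have w: "?tb \<sqinter> y \<in> carrier L" "b \<sqsubseteq> ?tb \<sqinter> y" "a \<sqsubseteq> ?tb \<sqinter> y"
          using tb a_tb by' ac a assms(3) by (auto intro: meet_le)
        \<comment> \<open>Equality would put \<open>a\<close> below \<open>b\<close>, but distinct
          covers of \<open>x\<close> are incomparable. So \<open>b\<close> has a cover
          \<open>z\<close> below both \<open>y\<close> and \<open>?tb\<close>, whose label does not
          exceed that of \<open>b\<close>.\<close>
        then have "b \<sqsubset> ?tb \<sqinter> y"
          using a b(2) ba by (auto simp: covers_def lless_eq)
        then obtain z where z: "covers L b z" "z \<sqsubseteq> ?tb \<sqinter> y"
          using ex_cover_below w by' by blast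
        have zc: "z \<in> carrier L" "b \<sqsubseteq> z" "b \<noteq> z"
          using z by (auto simp: covers_def lless_eq)
        have zy: "z \<sqsubseteq> y" "z \<sqsubseteq> ?tb"
          using z zc w tb assms(3) meet_left[of ?tb y] meet_right[of ?tb y]
            le_trans[of z "?tb \<sqinter> y"] by auto
        obtain e where e: "maximal_chain L z y e"
          using ex_maximal_chain zc zy assms(3) by blast
        have lz: "lab (r @ [b]) z \<le> lab r b"
          using lab_next_le_iff[OF less.prems(1) b(2) z(1)] zy by simp
        have "b \<noteq> y"
          using zc zy by' le_antisym[of b z] by auto
        then obtain z' d'' where z': "d' = z' # d''"
          using b(3) by (cases d') (auto simp: maximal_chain_def)
        have be: "maximal_chain L b y (b # e)"
          using maximal_chain_Cons[OF z(1) e] .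
        have etl: "e = z # tl e"
          using maximal_chain_hd[OF e] .
        have "z' \<noteq> z"
          using first lz by (auto simp: z')
        then have "b # e \<noteq> b # d'"
          using etl z' by (metis list.inject)
        \<comment> \<open>As \<open>b # d'\<close> is increasing, by induction it is
          lexicographically first from \<open>b\<close> to \<open>y\<close>. So its first label is
          at most that of \<open>z\<close>, which contradicts the increase from \<open>b\<close> to
          \<open>z'\<close>.\<close>
        then have "(label_word lab (r @ [b]) d', label_word lab (r @ [b]) e) \<in> lexord {(a, b). a < b}"
          using IH[OF b(2) by'(1)] inc' be by fastforce
        then have "lab (r @ [b]) z' \<le> lab (r @ [b]) z"
          unfolding word[OF e] z' by auto
        then show ?thesis
          using first lz by (auto simp: z')
      qed
    qed
    have lex: "(label_word lab r c, label_word lab r (tl d)) \<in> lexord {(a, b). a < b}"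
      if d: "maximal_chain L x y d" "d \<noteq> x # c" for d
    proof -
      obtain b d' where b: "d = x # b # d'" "covers L x b" "maximal_chain L b y (b # d')"
        using maximal_chainE[OF d(1) False] by metis
      show ?thesis
      proof (cases "b = a")
        case True
        then have "(label_word lab (r @ [a]) (tl c), label_word lab (r @ [a]) d') \<in> lexord {(a, b). a < b}"
          using c b d by (metis list.sel(3))
        then show ?thesis
          unfolding word[OF cmax] b using True by simp
      next
        case ba: False
        have "lab r a < lab r b"
          using amin[OF b(2) _ ba] maximal_chain_le[OF b(3)] by simp
        then show ?thesis
          unfolding word[OF cmax] b by simp
      qed
    qed
    show ?thesis
      by (rule exI[of _ "x # c"]) (use inc uniq lex in \<open>unfold list.sel, blast\<close>)
  qed
qed

lemma CL_labeling_lab: "CL_labeling L lab"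
  unfolding CL_labeling_def
proof (intro ballI allI impI, elim conjE)
  fix x y r
  assume "x \<in> carrier L" "y \<in> carrier L" "x \<sqsubseteq> y" "maximal_chain L \<bottom> x r"
  then show "\<exists>c. increasing_chain L lab r x y c \<and>
             (\<forall>d. increasing_chain L lab r x y d \<longrightarrow> d = c) \<and>
             (\<forall>d. maximal_chain L x y d \<and> d \<noteq> c \<longrightarrow>
                (label_word lab r (tl c), label_word lab r (tl d)) \<in> lexord {(a, b). a < b})"
    by (intro rooted_interval) (auto simp: maximal_chain_def root_def)
qed

end

theorem comodernistic_imp_CL_shellable:
  assumes "comodernistic L" "finite (carrier L)"
  shows "CL_shellable L"
\<comment> \<open>\<open>lattice\<close> admits an empty carrier, where there is no top to start
  chains from; the labeling condition is then vacuous.\<close>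
proof (cases "carrier L = {}")
  case True
  then show ?thesis
    by (simp add: CL_shellable_def CL_labeling_def)
next
  case False
  interpret lattice L
    using assms by (simp add: comodernistic_def)
  interpret finite_comodernistic_lattice L
  proof
    fix u v assume uv: "u \<in> carrier L" "v \<in> carrier L" "u \<sqsubset>\<^bsub>L\<^esub> v"
    then show "\<exists>m. lm_coatom u v m"
      using assms(1) left_modular_coatom_interval_iff[of u v]
      unfolding comodernistic_def by (metis lless_imp_le)
  qed (use assms False in auto)
  show ?thesis
    using CL_labeling_lab by (auto simp: CL_shellable_def)
qed


section \<open>The order congruence lattice\<close>

text \<open>The join of \<open>x\<close> and \<open>y\<close> is the meet of their common upper
  bounds, a finite set that contains \<open>t\<close>.\<close>

lemma (in lower_semilattice) finite_lattice_if_bounded_above: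
  assumes "finite (carrier L)" "t \<in> carrier L" "\<And>x. x \<in> carrier L \<Longrightarrow> x \<sqsubseteq> t"
  shows "lattice L"
proof
  fix x y assume xy: "x \<in> carrier L" "y \<in> carrier L"
  let ?U = "Upper L {x, y}"
  have "greatest L (\<Sqinter>?U) (Lower L ?U)"
    using assms xy finite_subset[of ?U "carrier L"]
    by (intro finite_inf_greatest) (auto simp: Upper_def)
  then have "least L (\<Sqinter>?U) ?U"
    using xy by (auto simp: greatest_def least_def Lower_def Upper_def)
  then show "\<exists>s. least L s ?U" ..
qed

section \<open>Order congruences as level sets of integer-valued maps\<close>

locale finite_poset = partial_order P for P :: "'a gorder" (structure) +
  assumes finite_carrier: "finite (carrier P)"
begin

definition mono_int :: "('a \<Rightarrow> int) \<Rightarrow> bool" where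
  "mono_int f \<longleftrightarrow> (\<forall>p\<in>carrier P. \<forall>q\<in>carrier P. p \<sqsubseteq> q \<longrightarrow> f p \<le> f q)"

definition levels :: "('a \<Rightarrow> int) \<Rightarrow> 'a set set" where
  "levels f = level_set_partition P int_order f"

abbreviation OC :: "'a set set gorder" where
  "OC \<equiv> order_congruence_lattice P"

lemma carrier_OC: "carrier OC = {levels f | f. mono_int f}"
proof -
  have "order_preserving_map P int_order f \<longleftrightarrow> mono_int f" for f
    using partial_order_axioms partial_order_int
    by (auto simp: order_preserving_map_def mono_int_def isotone_def partial_order_def)
  then show ?thesis
    by (simp add: order_congruence_lattice_def order_congruences_eq_int[OF finite_carrier] levels_def)
qed

lemma levels_in_OC: "mono_int f \<Longrightarrow> levels f \<in> carrier OC"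
  by (auto simp: carrier_OC)

lemma in_OC_E:
  assumes "x \<in> carrier OC"
  obtains f where "mono_int f" "x = levels f"
  using assms by (auto simp: carrier_OC)

lemma levels_eq: "levels f = (\<lambda>p. {q \<in> carrier P. f q = f p}) ` carrier P"
  unfolding levels_def by (rule level_set_partition_eq) simp

lemma partition_on_levels: "partition_on (carrier P) (levels f)"
  unfolding levels_def by (rule partition_on_level_set_partition) simp

text \<open>Turns refinement of partitions into implication between the kernels of maps, so that
  later arguments compare values instead of blocks.\<close>

lemma le_OC_iff:
  "levels f \<sqsubseteq>\<^bsub>OC\<^esub> levels g \<longleftrightarrow> (\<forall>p\<in>carrier P. \<forall>q\<in>carrier P. f p = f q \<longrightarrow> g p = g q)"
  (is "?L \<longleftrightarrow> ?R")
proof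
  assume ?L
  then have fg: "\<exists>Y\<in>levels g. X \<subseteq> Y" if "X \<in> levels f" for X
    using that by (simp add: order_congruence_lattice_def refines_def)
  show ?R
  proof (intro ballI impI)
    fix p q assume pq: "p \<in> carrier P" "q \<in> carrier P" "f p = f q"
    then obtain Y where "Y \<in> levels g" "{r \<in> carrier P. f r = f q} \<subseteq> Y"
      using fg[of "{r \<in> carrier P. f r = f q}"] by (auto simp: levels_eq)
    then have "Y \<in> levels g" "p \<in> Y" "q \<in> Y"
      using pq by auto
    then show "g p = g q"
      by (auto simp: levels_eq)
  qed
next
  assume ?R
  then have "\<exists>Y\<in>levels g. X \<subseteq> Y" if X: "X \<in> levels f" for X
  proof -
    obtain p where "p \<in> carrier P" "X = {q \<in> carrier P. f q = f p}"
      using X by (auto simp: levels_eq)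
    then have "X \<subseteq> {q \<in> carrier P. g q = g p}" "{q \<in> carrier P. g q = g p} \<in> levels g"
      using \<open>?R\<close> unfolding levels_eq by blast+
    then show ?thesis ..
  qed
  then show ?L
    using partition_on_levels by (simp add: order_congruence_lattice_def refines_def)
qed

lemma partial_order_OC: "partial_order OC"
proof (rule partial_orderI)
  fix x y assume "x \<sqsubseteq>\<^bsub>OC\<^esub> y" "y \<sqsubseteq>\<^bsub>OC\<^esub> x"
  then show "x = y"
    unfolding order_congruence_lattice_def using refines_asym by simp
next
  fix x y z assume "x \<sqsubseteq>\<^bsub>OC\<^esub> y" "y \<sqsubseteq>\<^bsub>OC\<^esub> z"
  then show "x \<sqsubseteq>\<^bsub>OC\<^esub> z"
    unfolding order_congruence_lattice_def using refines_trans by simp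
next
  fix x assume "x \<in> carrier OC"
  then show "x \<sqsubseteq>\<^bsub>OC\<^esub> x"
    by (auto simp: carrier_OC le_OC_iff)
qed (simp add: order_congruence_lattice_def)

text \<open>Pairing the two maps gives an order-preserving map to the product order on pairs of
  integers; a linear extension on its finite image brings the values back to the integers. This
  yields the meets in \<open>OC\<close>.\<close>

lemma ex_common_refinement:
  assumes "mono_int f" "mono_int g"
  shows "\<exists>h. mono_int h \<and>
    (\<forall>p\<in>carrier P. \<forall>q\<in>carrier P. h p = h q \<longleftrightarrow> f p = f q \<and> g p = g q)"
proof -
  let ?Q = "\<lparr>carrier = UNIV, eq = (=), le = (\<lambda>x y. fst x \<le> fst y \<and> snd x \<le> snd y)\<rparr>
    :: (int \<times> int) gorder"
  let ?fg = "\<lambda>p. (f p, g p)"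
  have "partial_order ?Q"
    by (rule partial_orderI) (auto simp: prod_eq_iff)
  from linear_extension[OF this, of "?fg ` carrier P"] finite_carrier
  obtain k :: "int \<times> int \<Rightarrow> int" where k: "inj_on k (?fg ` carrier P)"
    "\<forall>x\<in>?fg ` carrier P. \<forall>y\<in>?fg ` carrier P. fst x \<le> fst y \<and> snd x \<le> snd y \<longrightarrow> k x \<le> k y"
    by auto
  have "mono_int (k \<circ> ?fg)"
    using k(2) assms by (auto simp: mono_int_def)
  moreover have "(k \<circ> ?fg) p = (k \<circ> ?fg) q \<longleftrightarrow> f p = f q \<and> g p = g q"
    if "p \<in> carrier P" "q \<in> carrier P" for p q
    using inj_on_eq_iff[OF k(1), of "?fg p" "?fg q"] that by auto
  ultimately show ?thesis by blast
qed

lemma finite_OC: "finite (carrier OC)"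
proof (rule finite_subset)
  show "carrier OC \<subseteq> Pow (Pow (carrier P))"
    by (auto simp: carrier_OC levels_eq)
qed (use finite_carrier in simp)

text \<open>Meets are common refinements, a constant map gives the greatest element, and finiteness
  then supplies the joins.\<close>

lemma lattice_OC: "lattice OC"
proof -
  interpret OC: partial_order OC by (rule partial_order_OC)
  interpret OC: lower_semilattice OC
  proof
    fix x y assume "x \<in> carrier OC" "y \<in> carrier OC"
    then obtain f g where fg: "mono_int f" "mono_int g" "x = levels f" "y = levels g"
      by (metis in_OC_E)
    obtain h where h: "mono_int h"
      "\<forall>p\<in>carrier P. \<forall>q\<in>carrier P. h p = h q \<longleftrightarrow> f p = f q \<and> g p = g q"
      using ex_common_refinement[OF fg(1,2)] by blast
    have "greatest OC (levels h) (Lower OC {x, y})"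
    proof (rule greatest_LowerI)
      fix z assume "z \<in> Lower OC {x, y}"
      then have z: "z \<in> carrier OC" "z \<sqsubseteq>\<^bsub>OC\<^esub> x" "z \<sqsubseteq>\<^bsub>OC\<^esub> y"
        using \<open>x \<in> carrier OC\<close> \<open>y \<in> carrier OC\<close> by (simp_all add: Lower_def)
      from z(1) obtain e where "z = levels e"
        by (rule in_OC_E)
      then show "z \<sqsubseteq>\<^bsub>OC\<^esub> levels h"
        using h(2) z(2,3) unfolding fg by (metis le_OC_iff)
    next
      fix z assume "z \<in> {x, y}"
      then show "levels h \<sqsubseteq>\<^bsub>OC\<^esub> z"
        using h(2) unfolding fg by (metis insertE emptyE le_OC_iff)
    qed (simp_all add: levels_in_OC h(1) \<open>x \<in> carrier OC\<close> \<open>y \<in> carrier OC\<close>)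
    then show "\<exists>s. greatest OC s (Lower OC {x, y})" ..
  qed
  show ?thesis
  proof (rule OC.finite_lattice_if_bounded_above[OF finite_OC])
    show "levels (\<lambda>_. 0) \<in> carrier OC"
      by (simp add: levels_in_OC mono_int_def)
    show "x \<sqsubseteq>\<^bsub>OC\<^esub> levels (\<lambda>_. 0)" if "x \<in> carrier OC" for x
      using that by (elim in_OC_E) (simp add: le_OC_iff)
  qed
qed

text \<open>
  The coatom splits a block \<open>B\<close> of \<open>levels g\<close> by removing from it the topmost block \<open>X\<close> of
  \<open>levels f\<close> contained in \<open>B\<close>; being topmost makes the split order-preserving.
\<close>

lemma ex_coatom_map:
  assumes f: "mono_int f" and g: "mono_int g"
    and fg: "\<forall>p\<in>carrier P. \<forall>q\<in>carrier P. f p = f q \<longrightarrow> g p = g q"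
    and pq: "p0 \<in> carrier P" "q0 \<in> carrier P" "g p0 = g q0" "f p0 \<noteq> f q0"
  obtains h X where "mono_int h"
    and "\<forall>p q. h p = h q \<longleftrightarrow> g p = g q \<and> (p \<in> X \<longleftrightarrow> q \<in> X)"
    and "X \<subseteq> carrier P"
    and "\<forall>p\<in>X. \<forall>q\<in>carrier P. q \<in> X \<longleftrightarrow> f q = f p"
    and "\<forall>p\<in>X. \<forall>q\<in>X. g p = g q"
    and "\<exists>p\<in>X. \<exists>q\<in>carrier P - X. g p = g q"
proof -
  define B where "B = {p \<in> carrier P. g p = g p0}"
  define k where "k = Max (f ` B)"
  define X where "X = {p \<in> B. f p = k}"
  \<comment> \<open>Doubling \<open>g\<close> leaves the odd values free: \<open>X\<close> moves
    just above the rest of its block and stays below the next level of \<open>g\<close>.\<close>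
  define h where "h p = 2 * g p + (if p \<in> X then 1 else 0)" for p
  have B: "finite B" "p0 \<in> B" "q0 \<in> B"
    using finite_carrier pq by (auto simp: B_def)
  have max: "f p \<le> k" if "p \<in> B" for p
    using that B by (simp add: k_def)
  have "k \<in> f ` B"
    unfolding k_def using B by (intro Max_in) auto
  then obtain x where x: "x \<in> X"
    by (auto simp: X_def)
  have iff: "h p = h q \<longleftrightarrow> g p = g q \<and> (p \<in> X \<longleftrightarrow> q \<in> X)" for p q
    unfolding h_def by (cases "p \<in> X"; cases "q \<in> X"; simp; presburger)
  have "mono_int h"
    unfolding mono_int_def
  proof (intro ballI impI)
    fix p q assume pq: "p \<in> carrier P" "q \<in> carrier P" "p \<sqsubseteq> q"
    then have le: "g p \<le> g q" "f p \<le> f q"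
      using f g by (auto simp: mono_int_def)
    \<comment> \<open>Here it matters that \<open>X\<close> is topmost: \<open>f q\<close> is at
      least \<open>f p = k\<close>, the largest value on \<open>B\<close>.\<close>
    have "q \<in> X" if "p \<in> X" "g p = g q"
      using that pq le(2) max[of q] by (auto simp: X_def B_def)
    then show "h p \<le> h q"
      using le(1) by (cases "g p = g q") (auto simp: h_def)
  qed
  moreover have "\<exists>p\<in>X. \<exists>q\<in>carrier P - X. g p = g q"
  proof -
    have "p0 \<notin> X \<or> q0 \<notin> X"
      using pq by (auto simp: X_def)
    then obtain q where "q \<in> B" "q \<notin> X"
      using B by blast
    then have "q \<in> carrier P - X" "g x = g q"
      using x by (auto simp: X_def B_def)
    then show ?thesis
      using x by blast
  qed
  moreover have "q \<in> X \<longleftrightarrow> f q = f p" if "p \<in> X" "q \<in> carrier P" for p q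
    using that fg[rule_format, of q p] by (auto simp: X_def B_def)
  moreover have "g p = g q" if "p \<in> X" "q \<in> X" for p q
    using that by (simp add: X_def B_def)
  moreover have "X \<subseteq> carrier P"
    by (auto simp: X_def B_def)
  ultimately show thesis
    using iff by (intro that[of h X]) blast+
qed

text \<open>The coatom \<open>m\<close> splits \<open>X\<close> off its block of \<open>v\<close>.
  Anything between \<open>u\<close> and \<open>v\<close> that is not below \<open>m\<close>
  reconnects \<open>X\<close>, so its join with \<open>m\<close> is \<open>v\<close>; left
  modularity then amounts to \<open>x \<squnion> (m \<sqinter> y) = y\<close>. For \<open>x\<close>
  below \<open>m\<close> both sides are \<open>m \<sqinter> y\<close>.\<close>

lemma ex_lm_coatom_OC:
  assumes uv: "u \<in> carrier OC" "v \<in> carrier OC" "u \<sqsubset>\<^bsub>OC\<^esub> v"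
  shows "\<exists>m. lattice.lm_coatom OC u v m"
proof -
  interpret OC: lattice OC by (rule lattice_OC)
  obtain f g where fg: "mono_int f" "mono_int g" and u: "u = levels f" and v: "v = levels g"
    using uv(1,2) by (metis in_OC_E)
  have le_uv: "\<forall>p\<in>carrier P. \<forall>q\<in>carrier P. f p = f q \<longrightarrow> g p = g q"
    using uv(3) unfolding u v OC.lless_eq le_OC_iff by blast
  have "\<not> v \<sqsubseteq>\<^bsub>OC\<^esub> u"
    using uv OC.le_antisym unfolding OC.lless_eq by blast
  then obtain p0 q0 where p0: "p0 \<in> carrier P" "q0 \<in> carrier P" "g p0 = g q0" "f p0 \<noteq> f q0"
    unfolding u v le_OC_iff by blast
  obtain h X where h: "mono_int h"
    and h_iff: "\<forall>p q. h p = h q \<longleftrightarrow> g p = g q \<and> (p \<in> X \<longleftrightarrow> q \<in> X)"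
    and X: "X \<subseteq> carrier P"
    and Xf: "\<forall>p\<in>X. \<forall>q\<in>carrier P. q \<in> X \<longleftrightarrow> f q = f p"
    and Xg: "\<forall>p\<in>X. \<forall>q\<in>X. g p = g q"
    and split: "\<exists>p\<in>X. \<exists>q\<in>carrier P - X. g p = g q"
    by (rule ex_coatom_map[OF fg le_uv p0])
  note h_iff = h_iff[rule_format] and Xf = Xf[rule_format] and Xg = Xg[rule_format]
  define m where "m = levels h"
  have m: "m \<in> carrier OC"
    using h by (simp add: m_def levels_in_OC)
  have um: "u \<sqsubseteq>\<^bsub>OC\<^esub> m"
    unfolding u m_def le_OC_iff h_iff using le_uv Xf by metis
  have mv: "m \<sqsubseteq>\<^bsub>OC\<^esub> v"
    unfolding v m_def le_OC_iff h_iff by blast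
  have "\<not> v \<sqsubseteq>\<^bsub>OC\<^esub> m"
    unfolding v m_def le_OC_iff h_iff using split X by blast
  then have "m \<noteq> v"
    using uv(2) OC.le_refl by blast
  \<comment> \<open>Above \<open>u\<close> and below \<open>v\<close>, not being below \<open>m\<close> means gluing \<open>X\<close> to another part of its block.\<close>
  have crossing: "\<exists>p\<in>X. \<exists>q\<in>carrier P - X. e p = e q \<and> g p = g q"
    if e: "levels e \<sqsubseteq>\<^bsub>OC\<^esub> v" "\<not> levels e \<sqsubseteq>\<^bsub>OC\<^esub> m" for e
  proof -
    obtain p q where pq: "p \<in> carrier P" "q \<in> carrier P" "e p = e q" "h p \<noteq> h q"
      using e(2) unfolding m_def le_OC_iff by blast
    then have "g p = g q"
      using e(1) pq unfolding v le_OC_iff by blast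
    with pq show ?thesis
      unfolding h_iff by (metis DiffI)
  qed
  have coatom: "z = v"
    if z: "z \<in> carrier OC" "m \<sqsubseteq>\<^bsub>OC\<^esub> z" "z \<sqsubseteq>\<^bsub>OC\<^esub> v" "\<not> z \<sqsubseteq>\<^bsub>OC\<^esub> m" for z
  proof (rule OC.le_antisym[OF z(3) _ z(1) uv(2)])
    obtain e where e: "z = levels e"
      using z(1) by (rule in_OC_E)
    obtain p q where pq: "p \<in> X" "q \<in> carrier P" "q \<notin> X" "e p = e q" "g p = g q"
      using crossing[of e] z(3,4) unfolding e by blast
    have he: "e s = e t" if "s \<in> carrier P" "t \<in> carrier P" "g s = g t" "s \<in> X \<longleftrightarrow> t \<in> X" for s t
      using z(2) that unfolding e m_def le_OC_iff h_iff by blast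
    \<comment> \<open>\<open>e\<close> is constant on \<open>X\<close> and on the rest of its block;
      the pair \<open>p\<close>, \<open>q\<close> links the two values.\<close>
    have mix: "e s = e t" if "s \<in> X" "t \<in> carrier P" "t \<notin> X" "g s = g t" for s t
    proof -
      have "e s = e p" "e t = e q"
        using that pq X Xg[of s p] by (metis he subsetD)+
      then show ?thesis
        using pq by simp
    qed
    have "e s = e t" if st: "s \<in> carrier P" "t \<in> carrier P" "g s = g t" for s t
      using st he[of s t] mix[of s t] mix[of t s] by metis
    then show "v \<sqsubseteq>\<^bsub>OC\<^esub> z"
      unfolding e v le_OC_iff by blast
  qed
  have "covers OC m v"
    unfolding covers_def OC.lless_eq using m uv mv \<open>m \<noteq> v\<close> coatom OC.le_antisym by blast
  moreover have "(x \<squnion>\<^bsub>OC\<^esub> m) \<sqinter>\<^bsub>OC\<^esub> y = x \<squnion>\<^bsub>OC\<^esub> (m \<sqinter>\<^bsub>OC\<^esub> y)"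
    if x: "x \<in> carrier OC" "u \<sqsubseteq>\<^bsub>OC\<^esub> x" and y: "y \<in> carrier OC" "y \<sqsubseteq>\<^bsub>OC\<^esub> v"
      and xy: "x \<sqsubseteq>\<^bsub>OC\<^esub> y" for x y
  proof (cases "x \<sqsubseteq>\<^bsub>OC\<^esub> m")
    case True
    have "x \<squnion>\<^bsub>OC\<^esub> m = m"
      using True x m OC.le_iff_meet by blast
    moreover have "x \<sqsubseteq>\<^bsub>OC\<^esub> m \<sqinter>\<^bsub>OC\<^esub> y"
      using True x y xy m by (intro OC.meet_le)
    then have "x \<squnion>\<^bsub>OC\<^esub> (m \<sqinter>\<^bsub>OC\<^esub> y) = m \<sqinter>\<^bsub>OC\<^esub> y"
      using x y m OC.le_iff_meet[of x "m \<sqinter>\<^bsub>OC\<^esub> y"] by simp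
    ultimately show ?thesis by simp
  next
    case False
    obtain a b where a: "x = levels a" and b: "y = levels b" "mono_int b"
      using x(1) y(1) by (metis in_OC_E)
    have xv: "x \<sqsubseteq>\<^bsub>OC\<^esub> v"
      using x y xy uv OC.le_trans by blast
    obtain p q where pq: "p \<in> X" "q \<in> carrier P" "q \<notin> X" "a p = a q" "g p = g q"
      using crossing[of a] False xv unfolding a by blast
    let ?xm = "x \<squnion>\<^bsub>OC\<^esub> m" and ?w = "x \<squnion>\<^bsub>OC\<^esub> (m \<sqinter>\<^bsub>OC\<^esub> y)"
    have "\<not> ?xm \<sqsubseteq>\<^bsub>OC\<^esub> m"
      using False x m OC.join_left[of x m] OC.le_trans[of x ?xm m] OC.join_closed by blast
    then have "?xm = v"
      using x m xv mv uv by (intro coatom OC.join_right OC.join_le OC.join_closed)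
    then have lhs: "?xm \<sqinter>\<^bsub>OC\<^esub> y = y"
      using y uv OC.le_iff_join[of y v] by (simp add: meet_comm)
    have wc: "?w \<in> carrier OC" "m \<sqinter>\<^bsub>OC\<^esub> y \<in> carrier OC"
      using x y m by simp_all
    have "?w = y"
    proof (rule OC.le_antisym[OF _ _ wc(1) y(1)])
      show "?w \<sqsubseteq>\<^bsub>OC\<^esub> y"
        using x y m xy wc by (intro OC.join_le OC.meet_right)
      obtain e where e: "?w = levels e"
        using wc(1) by (rule in_OC_E)
      \<comment> \<open>Points with equal values of \<open>h\<close> and of \<open>b\<close> are
        glued in both \<open>m\<close> and \<open>y\<close>, hence in \<open>m \<sqinter> y\<close>
        and in \<open>?w\<close>; \<open>k\<close> realizes these classes by an integer-valued
        map.\<close>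
      obtain k where k: "mono_int k"
        "\<forall>p\<in>carrier P. \<forall>q\<in>carrier P. k p = k q \<longleftrightarrow> h p = h q \<and> b p = b q"
        using ex_common_refinement[OF h b(2)] by blast
      have kc: "levels k \<in> carrier OC"
        using k(1) by (rule levels_in_OC)
      have "levels k \<sqsubseteq>\<^bsub>OC\<^esub> m \<sqinter>\<^bsub>OC\<^esub> y"
        using m y(1) kc
      proof (intro OC.meet_le)
        show "levels k \<sqsubseteq>\<^bsub>OC\<^esub> m" "levels k \<sqsubseteq>\<^bsub>OC\<^esub> y"
          using k(2) unfolding m_def b le_OC_iff by blast+
      qed
      moreover have "m \<sqinter>\<^bsub>OC\<^esub> y \<sqsubseteq>\<^bsub>OC\<^esub> ?w"
        using x wc by (intro OC.join_right)
      ultimately have "levels k \<sqsubseteq>\<^bsub>OC\<^esub> levels e"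
        using kc wc e OC.le_trans by metis
      then have ke: "e s = e t"
        if "s \<in> carrier P" "t \<in> carrier P" "g s = g t" "s \<in> X \<longleftrightarrow> t \<in> X" "b s = b t" for s t
        using k(2) that unfolding le_OC_iff h_iff by blast
      have "x \<sqsubseteq>\<^bsub>OC\<^esub> ?w"
        using x wc by (intro OC.join_left)
      then have "levels a \<sqsubseteq>\<^bsub>OC\<^esub> levels e"
        by (simp only: e flip: a)
      then have ae: "e s = e t" if "s \<in> carrier P" "t \<in> carrier P" "a s = a t" for s t
        using that unfolding le_OC_iff by blast
      have ab: "b s = b t" if "s \<in> carrier P" "t \<in> carrier P" "a s = a t" for s t
        using that xy unfolding a b le_OC_iff by blast
      have bg: "g s = g t" if "s \<in> carrier P" "t \<in> carrier P" "b s = b t" for s t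
        using that y(2) unfolding v b le_OC_iff by blast
      \<comment> \<open>A path from \<open>s\<close> to \<open>t\<close> inside the join:
        \<open>s\<close> and \<open>p\<close> lie in \<open>X\<close>, a single block of
        \<open>u\<close>, so \<open>x\<close> glues them; \<open>x\<close> also glues
        \<open>p\<close> to \<open>q\<close>; and \<open>q\<close>, \<open>t\<close> are both
        outside \<open>X\<close> and in one block of \<open>y\<close>, so
        \<open>m \<sqinter> y\<close> glues them.\<close>
      have mix: "e s = e t" if st: "s \<in> X" "t \<in> carrier P" "t \<notin> X" "b s = b t" for s t
      proof -
        have sc: "s \<in> carrier P" "p \<in> carrier P"
          using st pq X by auto
        have "f s = f p"
          using Xf[of p s] st pq sc by simp
        then have "a s = a p"
          using x(2) sc unfolding a u le_OC_iff by blast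
        then have sq: "a s = a q"
          using pq by simp
        have "b q = b t"
          using ab[OF sc(1) pq(2) sq] st by simp
        then have "e q = e t"
          using ke[OF pq(2) st(2) bg[OF pq(2) st(2)]] st(3) pq(3) by simp
        then show ?thesis
          using ae[OF sc(1) pq(2) sq] by simp
      qed
      have "e s = e t" if st: "s \<in> carrier P" "t \<in> carrier P" "b s = b t" for s t
        using st ke[of s t] bg[of s t] mix[of s t] mix[of t s] by metis
      then have "levels b \<sqsubseteq>\<^bsub>OC\<^esub> levels e"
        unfolding le_OC_iff by blast
      then show "y \<sqsubseteq>\<^bsub>OC\<^esub> ?w"
        by (simp only: e flip: b(1))
    qed
    then show ?thesis
      using lhs by simp
  qed
  ultimately have "OC.lm_coatom u v m"
    using um by (simp add: OC.lm_coatom_def at_least_at_most_def OC.lless_eq)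
  then show ?thesis ..
qed

lemma comodernistic_OC: "comodernistic OC"
proof -
  interpret OC: lattice OC by (rule lattice_OC)
  show ?thesis
    unfolding comodernistic_def
    using lattice_OC ex_lm_coatom_OC OC.left_modular_coatom_interval_iff
    by (metis lless_imp_le)
qed

end

theorem theorem1p5:
  fixes P :: "'a gorder"
  assumes "partial_order P" and "finite (carrier P)"
  shows "comodernistic (order_congruence_lattice P) \<and> CL_shellable (order_congruence_lattice P)"
proof -
  interpret finite_poset P
    using assms by (simp add: finite_poset_def finite_poset_axioms_def)
  show ?thesis
    using comodernistic_OC finite_OC comodernistic_imp_CL_shellable by blast
qed

end
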